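(* Assume that the continuity and compactness condition holds, that the strict dissipativity condition holds with a minimal optimal periodic orbit $\varPi^\star$, that the local controllability condition at $\varPi^\star$ and the finite-time reachability condition for $\varPi^\star$ hold, and that $\beta$ is a discount function (in the sense of the context). Let $x\in\mathbb{X}$. Then $\bar V^\beta_\infty(x):=\lim_{N\to\infty}\bar V^\beta_N(x)$ exists and is finite.
   Context: Notation: $\mathbb{N}=\{1,2,\dots\}$; $\mathbb{I}_{[a,b]}$ is the set of integers in $[a,b]$; $[k]_p$ is the remainder of $k$ modulo $p$. $\alpha\in\mathcal{K}_\infty$ means $\alpha:[0,\infty)\to[0,\infty)$ is continuous, strictly increasing, $\alpha(0)=0$, $\lim_{t\to\infty}\alpha(t)=\infty$. System: $x(k+1)=f(x(k),u(k))$, $\mathbb{X}\subset\mathbb{R}^n$, $\mathbb{U}\subset\mathbb{R}^m$, $f:\mathbb{X}\times\mathbb{U}\to\mathbb{R}^n$, stage cost $\ell:\mathbb{X}\times\mathbb{U}\to\mathbb{R}$. $x_u(0,x)=x$, $x_u(k+1,x)=f(x_u(k,x),u(k))$. $\mathbb{U}^N(x)=\{u\in\mathbb{U}^N: x_u(k,x)\in\mathbb{X}\ \forall k\in\mathbb{I}_{[0,N]}\}$; $\mathbb{U}^\infty(x)$ is the analogous set of infinite sequences. $\ell^\star=\inf_{u\in\mathbb{U}^\infty(x)}\liminf_{N\to\infty}\frac1N\sum_{k=0}^{N-1}\ell(x_u(k,x),u(k))$, assumed to be a constant independent of $x$; $\bar\ell=\ell-\ell^\star$. Discount function: $\beta:[0,1]\to[0,1]$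 is piecewise continuously differentiable, Lipschitz continuous with constant $L_\beta$, non-increasing, with $\beta(0)=1$, $\beta(1)=0$ and $\limsup_{\xi\to1}\beta'(\xi)<0$. Discounted value function: $\bar V^\beta_N(x)=\inf_{u\in\mathbb{U}^N(x)}\sum_{k=0}^{N-1}\beta(\tfrac kN)\,\bar\ell(x_u(k,x),u(k))$. Periodic orbits: a feasible $p$-periodic orbit is a tuple $\varPi=((x_0,u_0),\dots,(x_{p-1},u_{p-1}))\in(\mathbb{X}\times\mathbb{U})^p$, with $\varPi(k)=(x_k,u_k)$ and $\varPi_{\mathbb{X}}=(x_0,\dots,x_{p-1})$, such that $\varPi_{\mathbb{X}}([k+1]_p)=f(\varPi(k))$ for all $k\in\mathbb{I}_{[0,p-1]}$; $S^p_\varPi$ is the set of these. It is minimal if $\varPi_{\mathbb{X}}(k)=\varPi_{\mathbb{X}}(j)$ implies $k=j$. $\|(x,u)\|_\varPi=\min_k\|(x,u)-\varPi(k)\|$ and $\|x\|_{\varPi_{\mathbb{X}}}=\min_k\|x-\varPi_{\mathbb{X}}(k)\|$. $\ell^p(\varPi)=\frac1p\sum_{k=0}^{p-1}\ell(\varPi(k))$. A $p^\star$-periodic orbit $\varPi^\star$ is optimal if $\ell^{p^\star}(\varPi^\star)=\inf_{p\in\mathbb{N},\varPi\in S^p_\varPi}\ell^p(\varPi)$. Conditions. Continuity and compactness: $f,\ell$ are continuous, $\mathbb{X}\times\mathbb{U}$ is compact, and $\mathbb{U}^N(x)\neq\emptyset$ for all $x\in\mathbb{X}$, $N\in\mathbb{N}$.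 Strict dissipativity: there exist a minimal optimal periodic orbit $\varPi^\star$, a continuous $\lambda:\mathbb{X}\to\mathbb{R}$, $\bar\lambda\in\mathbb{R}$ with $|\lambda(x)|\le\bar\lambda$ on $\mathbb{X}$, and $\alpha_{\tilde\ell}\in\mathcal{K}_\infty$ with $\tilde\ell(x,u):=\bar\ell(x,u)+\lambda(x)-\lambda(f(x,u))\ge\alpha_{\tilde\ell}(\|(x,u)\|_{\varPi^\star})$ for all $x\in\mathbb{X}$, $u\in\mathbb{U}^1(x)$. Local controllability at $\varPi^\star$: there exist $\kappa>0$, $M'\in\mathbb{N}$, $\rho\in\mathcal{K}_\infty$ such that for all $z\in\varPi^\star_{\mathbb{X}}$ and all $x,y\in\mathbb{X}$ with $\|x-z\|\le\kappa$, $\|y-z\|\le\kappa$ there is $u\in\mathbb{U}^{M'}(x)$ with $x_u(M',x)=y$ and $\|(x_u(k,x),u(k))\|_{\varPi^\star}\le\rho(\max\{\|x\|_{\varPi^\star_{\mathbb{X}}},\|y\|_{\varPi^\star_{\mathbb{X}}}\})$ for all $k\in\mathbb{I}_{[0,M'-1]}$. Finite-time reachability of $\varPi^\star$: for the same $\kappa$ there is an integer $M''\ge1$ such that for all $x\in\mathbb{X}$ there exist $K\in\mathbb{I}_{[0,M'']}$ and $u\in\mathbb{U}^K(x)$ with $\|x_u(K,x)\|_{\varPi^\star_{\mathbb{X}}}\le\kappa$. *)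

theory Defs
  imports "HOL-Analysis.Analysis"
begin

definition class_K_inf :: "(real \<Rightarrow> real) \<Rightarrow> bool" where
  "class_K_inf \<alpha> \<longleftrightarrow>
     \<alpha> \<in> {0..} \<rightarrow> {0..} \<and> continuous_on {0..} \<alpha> \<and> strict_mono_on {0..} \<alpha> \<and>
     \<alpha> 0 = 0 \<and> filterlim \<alpha> at_top at_top"

text \<open>
  Piecewise continuous differentiability allows a finite exceptional set, which may contain the
  endpoints, so the values of \<open>\<beta>\<close> outside the unit interval play no role; \<open>\<beta>\<close> is then
  differentiable at every point of some left neighbourhood of \<open>1\<close>, where \<open>deriv\<close> is its derivative.
\<close>

definition discount_function :: "(real \<Rightarrow> real) \<Rightarrow> bool" where
  "discount_function \<beta> \<longleftrightarrow>
     \<beta> \<in> {0..1} \<rightarrow> {0..1} \<and>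
     \<beta> piecewise_C1_differentiable_on {0..1} \<and>
     (\<exists>L. lipschitz_on L {0..1} \<beta>) \<and>
     antimono_on {0..1} \<beta> \<and>
     \<beta> 0 = 1 \<and> \<beta> 1 = 0 \<and>
     Limsup (at_left 1) (\<lambda>\<xi>. ereal (deriv \<beta> \<xi>)) < 0"

primrec traj :: "('x \<times> 'u \<Rightarrow> 'x) \<Rightarrow> (nat \<Rightarrow> 'u) \<Rightarrow> 'x \<Rightarrow> nat \<Rightarrow> 'x" where
  "traj f u x 0 = x"
| "traj f u x (Suc k) = f (traj f u x k, u k)"

text \<open>
  A control sequence of length \<open>N\<close> is represented by an infinite sequence of which only the entries
  with index below \<open>N\<close> are constrained; the states up to time \<open>N\<close> depend on these entries only.
\<close>

definition admissible ::
    "('x \<times> 'u \<Rightarrow> 'x) \<Rightarrow> 'x set \<Rightarrow> 'u set \<Rightarrow> nat \<Rightarrow> 'x \<Rightarrow> (nat \<Rightarrow> 'u) set" where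
  "admissible f X U N x = {u. (\<forall>k<N. u k \<in> U) \<and> (\<forall>k\<le>N. traj f u x k \<in> X)}"

definition admissible_inf ::
    "('x \<times> 'u \<Rightarrow> 'x) \<Rightarrow> 'x set \<Rightarrow> 'u set \<Rightarrow> 'x \<Rightarrow> (nat \<Rightarrow> 'u) set" where
  "admissible_inf f X U x = {u. (\<forall>k. u k \<in> U) \<and> (\<forall>k. traj f u x k \<in> X)}"

definition optimal_average ::
    "('x \<times> 'u \<Rightarrow> 'x) \<Rightarrow> ('x \<times> 'u \<Rightarrow> real) \<Rightarrow> 'x set \<Rightarrow> 'u set \<Rightarrow> 'x \<Rightarrow> ereal" where
  "optimal_average f l X U x =
     (INF u\<in>admissible_inf f X U x.
        liminf (\<lambda>N. ereal ((1 / real N) * (\<Sum>k<N. l (traj f u x k, u k)))))"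

text \<open>The parameter \<open>c\<close> is the optimal average cost by which the stage cost is shifted.\<close>

definition discounted_value ::
    "('x \<times> 'u \<Rightarrow> 'x) \<Rightarrow> ('x \<times> 'u \<Rightarrow> real) \<Rightarrow> 'x set \<Rightarrow> 'u set \<Rightarrow> real \<Rightarrow> (real \<Rightarrow> real) \<Rightarrow>
     nat \<Rightarrow> 'x \<Rightarrow> ereal" where
  "discounted_value f l X U c \<beta> N x =
     (INF u\<in>admissible f X U N x.
        ereal (\<Sum>k<N. \<beta> (real k / real N) * (l (traj f u x k, u k) - c)))"

text \<open>
  A \<open>p\<close>-tuple of state-input pairs is represented by a function of which only the values below
  \<open>p\<close> matter.
\<close>

definition periodic_orbit ::
    "('x \<times> 'u \<Rightarrow> 'x) \<Rightarrow> 'x set \<Rightarrow> 'u set \<Rightarrow> nat \<Rightarrow> (nat \<Rightarrow> 'x \<times> 'u) \<Rightarrow> bool" where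
  "periodic_orbit f X U p orb \<longleftrightarrow>
     1 \<le> p \<and> (\<forall>k<p. orb k \<in> X \<times> U) \<and> (\<forall>k<p. fst (orb ((k + 1) mod p)) = f (orb k))"

definition minimal_orbit :: "nat \<Rightarrow> (nat \<Rightarrow> 'x \<times> 'u) \<Rightarrow> bool" where
  "minimal_orbit p orb \<longleftrightarrow> (\<forall>k<p. \<forall>j<p. fst (orb k) = fst (orb j) \<longrightarrow> k = j)"

definition orbit_cost :: "('x \<times> 'u \<Rightarrow> real) \<Rightarrow> nat \<Rightarrow> (nat \<Rightarrow> 'x \<times> 'u) \<Rightarrow> real" where
  "orbit_cost l p orb = (1 / real p) * (\<Sum>k<p. l (orb k))"

definition optimal_orbit ::
    "('x \<times> 'u \<Rightarrow> 'x) \<Rightarrow> ('x \<times> 'u \<Rightarrow> real) \<Rightarrow> 'x set \<Rightarrow> 'u set \<Rightarrow> nat \<Rightarrow> (nat \<Rightarrow> 'x \<times> 'u) \<Rightarrow> bool" where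
  "optimal_orbit f l X U p orb \<longleftrightarrow>
     periodic_orbit f X U p orb \<and>
     ereal (orbit_cost l p orb) =
       (INF (q, orb') \<in> {(q, orb'). periodic_orbit f X U q orb'}. ereal (orbit_cost l q orb'))"

text \<open>The norm on the product type is the Euclidean one.\<close>

definition orbit_dist ::
    "nat \<Rightarrow> (nat \<Rightarrow> 'x::real_normed_vector \<times> 'u::real_normed_vector) \<Rightarrow> 'x \<times> 'u \<Rightarrow> real" where
  "orbit_dist p orb z = (MIN k\<in>{..<p}. norm (z - orb k))"

definition orbit_state_dist ::
    "nat \<Rightarrow> (nat \<Rightarrow> 'x::real_normed_vector \<times> 'u) \<Rightarrow> 'x \<Rightarrow> real" where
  "orbit_state_dist p orb x = (MIN k\<in>{..<p}. norm (x - fst (orb k)))"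

definition continuity_compactness ::
    "('x::real_normed_vector \<times> 'u::real_normed_vector \<Rightarrow> 'x) \<Rightarrow> ('x \<times> 'u \<Rightarrow> real) \<Rightarrow>
     'x set \<Rightarrow> 'u set \<Rightarrow> bool" where
  "continuity_compactness f l X U \<longleftrightarrow>
     continuous_on (X \<times> U) f \<and> continuous_on (X \<times> U) l \<and> compact (X \<times> U) \<and>
     (\<forall>x\<in>X. \<forall>N\<ge>1. admissible f X U N x \<noteq> {})"

text \<open>
  A control value in \<open>U\<close> that keeps the next state in \<open>X\<close> is the entry \<open>u 0\<close> of an admissible
  sequence of length \<open>1\<close>.
\<close>

definition strictly_dissipative ::
    "('x::real_normed_vector \<times> 'u::real_normed_vector \<Rightarrow> 'x) \<Rightarrow> ('x \<times> 'u \<Rightarrow> real) \<Rightarrow>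
     'x set \<Rightarrow> 'u set \<Rightarrow> real \<Rightarrow> nat \<Rightarrow> (nat \<Rightarrow> 'x \<times> 'u) \<Rightarrow> bool" where
  "strictly_dissipative f l X U c p orb \<longleftrightarrow>
     minimal_orbit p orb \<and> optimal_orbit f l X U p orb \<and>
     (\<exists>(lam :: 'x \<Rightarrow> real) (lam_bar :: real) \<alpha>.
        continuous_on X lam \<and> (\<forall>x\<in>X. \<bar>lam x\<bar> \<le> lam_bar) \<and> class_K_inf \<alpha> \<and>
        (\<forall>x\<in>X. \<forall>u\<in>admissible f X U 1 x.
           (l (x, u 0) - c) + lam x - lam (f (x, u 0)) \<ge> \<alpha> (orbit_dist p orb (x, u 0))))"

definition locally_controllable ::
    "('x::real_normed_vector \<times> 'u::real_normed_vector \<Rightarrow> 'x) \<Rightarrow> 'x set \<Rightarrow> 'u set \<Rightarrow>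
     nat \<Rightarrow> (nat \<Rightarrow> 'x \<times> 'u) \<Rightarrow> real \<Rightarrow> bool" where
  "locally_controllable f X U p orb \<kappa> \<longleftrightarrow>
     \<kappa> > 0 \<and>
     (\<exists>M\<ge>1. \<exists>\<rho>. class_K_inf \<rho> \<and>
        (\<forall>z\<in>(\<lambda>k. fst (orb k)) ` {..<p}. \<forall>x\<in>X. \<forall>y\<in>X.
           norm (x - z) \<le> \<kappa> \<longrightarrow> norm (y - z) \<le> \<kappa> \<longrightarrow>
           (\<exists>u\<in>admissible f X U M x.
              traj f u x M = y \<and>
              (\<forall>k<M. orbit_dist p orb (traj f u x k, u k)
                 \<le> \<rho> (max (orbit_state_dist p orb x) (orbit_state_dist p orb y))))))"

definition finite_time_reachable ::
    "('x::real_normed_vector \<times> 'u \<Rightarrow> 'x) \<Rightarrow> 'x set \<Rightarrow> 'u set \<Rightarrow>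
     nat \<Rightarrow> (nat \<Rightarrow> 'x \<times> 'u) \<Rightarrow> real \<Rightarrow> bool" where
  "finite_time_reachable f X U p orb \<kappa> \<longleftrightarrow>
     (\<exists>M\<ge>1. \<forall>x\<in>X. \<exists>K\<le>M. \<exists>u\<in>admissible f X U K x.
        orbit_state_dist p orb (traj f u x K) \<le> \<kappa>)"

end

theory Submission
  imports Defs
begin

text \<open>
  Rotating the stage cost with the storage function \<open>\<lambda>\<close> and summing by parts turns the discounted cost
  of a control \<open>u\<close> into \<open>S\<^sub>N(u) - \<lambda>(x) + R\<^sub>N(u)\<close>, where \<open>S\<^sub>N(u)\<close> is the discounted sum of the nonnegative
  rotated costs and \<open>R\<^sub>N(u)\<close> is the average of \<open>\<lambda>\<close> along the path with weights
  \<open>\<beta>(k/N) - \<beta>((k+1)/N)\<close>. If \<open>S\<^sub>N(u)\<close> is bounded, then all but \<open>o(N)\<close> points of the path are close to the orbit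
  and run through it cyclically; since the weights vary slowly, \<open>R\<^sub>N(u)\<close> tends uniformly to the mean of
  \<open>\<lambda>\<close> over the orbit. The rotated cost vanishes on the orbit, because otherwise no path could have the
  optimal average cost. Hence \<open>inf S\<^sub>N\<close> tends to the minimal undiscounted rotated cost of
  steering \<open>x\<close> onto the orbit: after such a transfer one may stay on the orbit for free, and
  conversely a cheap path comes close to the orbit within a bounded time and can be steered onto it
  from there at small cost.
\<close>

section \<open>Weighted sums and discount weights\<close>

text \<open>Serves to count grid indices near a breakpoint of \<open>\<beta>\<close> and time steps
  near the end of the horizon. Such indices are integers between two roundings, and
  \<open>max 0\<close> in the proof covers an empty range.\<close>

lemma card_nat_near:
  fixes a b :: real
  assumes "b \<ge> 0"
  shows "finite {k::nat. \<bar>real k - a\<bar> < b}" and "real (card {k::nat. \<bar>real k - a\<bar> < b}) \<le> 2 * b + 1"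
proof -
  let ?S = "{k::nat. \<bar>real k - a\<bar> < b}"
  have sub: "int ` ?S \<subseteq> {\<lceil>a - b\<rceil>..\<lfloor>a + b\<rfloor>}"
    by (auto simp: abs_less_iff ceiling_le_iff le_floor_iff)
  then have "finite (int ` ?S)"
    by (rule finite_subset) simp
  then show "finite ?S"
    by (rule finite_imageD) simp
  have "card ?S = card (int ` ?S)"
    by (simp add: card_image)
  also have "\<dots> \<le> card {\<lceil>a - b\<rceil>..\<lfloor>a + b\<rfloor>}"
    by (rule card_mono) (use sub in auto)
  finally have "card ?S \<le> nat (\<lfloor>a + b\<rfloor> - \<lceil>a - b\<rceil> + 1)"
    by simp
  then have "real (card ?S) \<le> max 0 (of_int (\<lfloor>a + b\<rfloor> - \<lceil>a - b\<rceil> + 1))"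
    by linarith
  also have "\<dots> \<le> 2 * b + 1"
    using assms by linarith
  finally show "real (card ?S) \<le> 2 * b + 1" .
qed

lemma abs_diff_le_sum_increments:
  fixes w e :: "nat \<Rightarrow> real"
  assumes "\<And>t. a \<le> t \<Longrightarrow> t < k \<Longrightarrow> \<bar>w (Suc t) - w t\<bar> \<le> e t" and "a \<le> k"
  shows "\<bar>w k - w a\<bar> \<le> sum e {a..<k}"
proof -
  have "w k - w a = (\<Sum>t = a..<k. w (Suc t) - w t)"
    using sum_Suc_diff'[OF assms(2), of w] by simp
  also have "\<bar>\<dots>\<bar> \<le> (\<Sum>t = a..<k. \<bar>w (Suc t) - w t\<bar>)"
    by (rule sum_abs)
  also have "\<dots> \<le> sum e {a..<k}"
    by (rule sum_mono) (use assms in auto)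
  finally show ?thesis .
qed

text \<open>Within a block of length \<open>p\<close> the weights are replaced by the first one; the error is
  controlled by the total variation of the weights.\<close>

lemma weighted_block_sum_bound:
  fixes w g e d :: "nat \<Rightarrow> real"
  assumes p: "p > 0"
    and w: "\<And>k. k < N \<Longrightarrow> 0 \<le> w k \<and> w k \<le> W"
    and g: "\<And>k. k < N \<Longrightarrow> \<bar>g k\<bar> \<le> B" and B: "0 \<le> B"
    and e: "\<And>k. Suc k < N \<Longrightarrow> \<bar>w (Suc k) - w k\<bar> \<le> e k" "\<And>k. 0 \<le> e k"
    and d: "\<And>k. 0 \<le> d k"
    and block: "\<And>a. a + p \<le> N \<Longrightarrow> \<bar>sum g {a..<a + p}\<bar> \<le> \<eta> + B' * sum d {a..<a + p}"
    and pos: "0 \<le> \<eta>" "0 \<le> B'" "0 \<le> W"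
  shows "\<bar>\<Sum>k<N. w k * g k\<bar> \<le>
    real N * W * \<eta> + W * B' * sum d {..<N} + real p * B * sum e {..<N} + real p * W * B"
proof -
  \<comment> \<open>The \<open>q\<close> full blocks miss fewer than \<open>p\<close> indices; the
    leftover ones account for the last term of the bound.\<close>
  define q where "q = N div p"
  have "N = q * p + N mod p" "N mod p < p"
    using p by (auto simp: q_def)
  then have qN: "q * p \<le> N" "N < q * p + p"
    by linarith+
  have one: "\<bar>\<Sum>k = m * p..<m * p + p. w k * g k\<bar> \<le>
      W * (\<eta> + B' * sum d {m * p..<m * p + p}) + real p * B * sum e {m * p..<m * p + p}"
    if "m < q" for m
  proof -
    let ?a = "m * p"
    let ?A = "{?a..<?a + p}"
    have "(m + 1) * p \<le> q * p"
      using that by (intro mult_right_mono) auto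
    then have le: "?a + p \<le> N"
      using qN by simp
    have "(\<Sum>k\<in>?A. w k * g k) = w ?a * sum g ?A + (\<Sum>k\<in>?A. (w k - w ?a) * g k)"
      by (simp add: sum_distrib_left sum.distrib[symmetric] algebra_simps)
    moreover have "\<bar>w ?a * sum g ?A\<bar> \<le> W * (\<eta> + B' * sum d ?A)"
      unfolding abs_mult using block[OF le] w[of ?a] le p by (intro mult_mono) auto
    moreover have "\<bar>\<Sum>k\<in>?A. (w k - w ?a) * g k\<bar> \<le> (\<Sum>k\<in>?A. sum e ?A * B)"
    proof (rule order_trans[OF sum_abs sum_mono])
      fix k assume k: "k \<in> ?A"
      have "\<bar>w k - w ?a\<bar> \<le> sum e {?a..<k}"
        using e k le by (intro abs_diff_le_sum_increments) auto
      also have "\<dots> \<le> sum e ?A"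
        using k e by (intro sum_mono2) auto
      finally show "\<bar>(w k - w ?a) * g k\<bar> \<le> sum e ?A * B"
        unfolding abs_mult using g[of k] k le by (intro mult_mono sum_nonneg e) auto
    qed
    ultimately show ?thesis
      by (simp add: algebra_simps)
  qed
  have "(\<Sum>k<N. w k * g k) = (\<Sum>k<q * p. w k * g k) + (\<Sum>k = q * p..<N. w k * g k)"
    using qN by (metis (no_types, lifting) lessThan_atLeast0 sum.atLeastLessThan_concat zero_le)
  moreover have "\<bar>\<Sum>k<q * p. w k * g k\<bar> \<le>
      real N * W * \<eta> + W * B' * sum d {..<N} + real p * B * sum e {..<N}"
  proof -
    have "\<bar>\<Sum>k<q * p. w k * g k\<bar> \<le> (\<Sum>m<q. \<bar>\<Sum>k = m * p..<m * p + p. w k * g k\<bar>)"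
      unfolding sum.nat_group[symmetric] by (rule sum_abs)
    also have "\<dots> \<le> (\<Sum>m<q. W * (\<eta> + B' * sum d {m * p..<m * p + p})
        + real p * B * sum e {m * p..<m * p + p})"
      by (rule sum_mono) (use one in auto)
    also have "\<dots> = real q * W * \<eta> + W * B' * sum d {..<q * p} + real p * B * sum e {..<q * p}"
      unfolding sum.nat_group[symmetric] by (simp add: sum.distrib sum_distrib_left algebra_simps)
    also have "\<dots> \<le> real N * W * \<eta> + W * B' * sum d {..<N} + real p * B * sum e {..<N}"
    proof (intro add_mono mult_left_mono)
      show "real q * W * \<eta> \<le> real N * W * \<eta>"
        using div_le_dividend[of N p] pos by (simp add: q_def mult_right_mono)
      show "sum d {..<q * p} \<le> sum d {..<N}" "sum e {..<q * p} \<le> sum e {..<N}"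
        using qN d e by (auto intro!: sum_mono2)
    qed (use pos B in auto)
    finally show ?thesis .
  qed
  moreover have "\<bar>\<Sum>k = q * p..<N. w k * g k\<bar> \<le> real p * W * B"
  proof -
    have "\<bar>\<Sum>k = q * p..<N. w k * g k\<bar> \<le> (\<Sum>k = q * p..<N. W * B)"
    proof (rule order_trans[OF sum_abs sum_mono])
      fix k assume "k \<in> {q * p..<N}"
      then show "\<bar>w k * g k\<bar> \<le> W * B"
        unfolding abs_mult using w[of k] g[of k] by (intro mult_mono) auto
    qed
    also have "\<dots> = real (N - q * p) * (W * B)"
      by simp
    also have "\<dots> \<le> real p * (W * B)"
    proof (rule mult_right_mono)
      show "real (N - q * p) \<le> real p"
        using qN by linarith
    qed (use pos B in auto)
    finally show ?thesis by simp
  qed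
  ultimately show ?thesis by linarith
qed

section \<open>Positivity and slow variation of the discount\<close>

text \<open>The condition on \<open>deriv \<beta>\<close> near \<open>1\<close> enters here: by
  monotonicity a zero at \<open>\<xi>\<close> would persist on all of \<open>{\<xi><..<1}\<close>,
  so the derivative would vanish there and its limit superior could not be negative.\<close>

lemma discount_pos:
  assumes "discount_function \<beta>" "0 \<le> \<xi>" "\<xi> < 1"
  shows "\<beta> \<xi> > 0"
proof (rule ccontr)
  assume neg: "\<not> \<beta> \<xi> > 0"
  have zero: "\<beta> t = 0" if "t \<in> {\<xi><..<1}" for t
  proof -
    have "\<beta> t \<le> \<beta> \<xi>" "\<beta> t \<ge> 0"
      using assms that by (auto simp: discount_function_def monotone_on_def Pi_iff)
    then show ?thesis using neg by linarith
  qed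
  have der: "deriv \<beta> t = 0" if "t \<in> {\<xi><..<1}" for t
  proof (rule DERIV_imp_deriv)
    show "(\<beta> has_field_derivative 0) (at t)"
      by (rule has_field_derivative_transform_within_open[where f = "\<lambda>_. 0" and S = "{\<xi><..<1}"])
        (use that zero in auto)
  qed
  have "eventually (\<lambda>t. ereal (deriv \<beta> t) < 0) (at_left 1)"
    using assms by (intro Limsup_lessD) (auto simp: discount_function_def)
  moreover have "eventually (\<lambda>t. t \<in> {\<xi><..<1}) (at_left (1::real))"
    using assms by (intro eventually_at_leftI[of \<xi>]) auto
  ultimately have "eventually (\<lambda>t::real. False) (at_left 1)"
    by eventually_elim (use der in simp)
  then show False
    by (simp add: trivial_limit_at_left_real)
qed

text \<open>Away from the breakpoints, the mean value theorem turns a second difference into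
  \<open>1 / N\<close> times a difference of two nearby values of the derivative, which is small by
  uniform continuity. Near the breakpoints each term is at most \<open>2 * L / N\<close>, and the
  share of such indices is of the order of \<open>r\<close>.\<close>

lemma sum_second_differences_tendsto_0:
  fixes \<beta> :: "real \<Rightarrow> real"
  assumes pc: "\<beta> piecewise_C1_differentiable_on {0..1}" and lip: "L-lipschitz_on {0..1} \<beta>"
  shows "(\<lambda>N. \<Sum>k<N - 1. \<bar>(\<beta> (real (k + 2) / N) - \<beta> (real (k + 1) / N))
                      - (\<beta> (real (k + 1) / N) - \<beta> (real k / N))\<bar>) \<longlonglongrightarrow> 0"
    (is "(\<lambda>N. \<Sum>k<N - 1. ?t N k) \<longlonglongrightarrow> 0")
proof (rule LIMSEQ_I)
  fix \<epsilon> :: real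
  assume \<epsilon>: "0 < \<epsilon>"
  obtain T D where T: "finite T"
    and D: "\<And>s. s \<in> {0..1} - T \<Longrightarrow> (\<beta> has_vector_derivative D s) (at s)"
    and contD: "continuous_on ({0..1} - T) D"
    using pc unfolding piecewise_C1_differentiable_on_def C1_differentiable_on_def by blast
  have L: "L \<ge> 0"
    using lip by (rule lipschitz_on_nonneg)
  define a where "a = L * real (card T)"
  have a: "a \<ge> 0"
    using L by (simp add: a_def)
  \<comment> \<open>The indices near breakpoints will contribute
    \<open>2 * a * (2 * r + 5 / N)\<close>; this \<open>r\<close> keeps the limit
    \<open>4 * a * r\<close> below \<open>\<epsilon> / 2\<close>.\<close>
  define r where "r = \<epsilon> / (8 * (a + 1))"
  have r: "r > 0" "4 * a * r < \<epsilon> / 2"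
    using \<epsilon> a by (auto simp: r_def field_simps)
  \<comment> \<open>Removing open balls around \<open>T\<close> leaves a compact set on which
    \<open>D\<close> is uniformly continuous, although \<open>D\<close> may jump on
    \<open>T\<close>.\<close>
  define E where "E = {0..1} - (\<Union>t\<in>T. ball t r)"
  have "compact E"
    unfolding E_def by (intro compact_diff open_UN) auto
  moreover have ET: "E \<subseteq> {0..1} - T"
    using r by (auto simp: E_def)
  ultimately have "uniformly_continuous_on E D"
    using contD by (intro compact_uniformly_continuous) (auto intro: continuous_on_subset)
  then obtain d where d: "d > 0"
    "\<And>s s'. s \<in> E \<Longrightarrow> s' \<in> E \<Longrightarrow> dist s' s < d \<Longrightarrow> dist (D s') (D s) < \<epsilon> / 2"
    unfolding uniformly_continuous_on_def using \<epsilon> by (metis half_gt_zero)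
  have "(\<lambda>N. 2 * a * (2 * r + 5 / real N)) \<longlonglongrightarrow> 2 * a * (2 * r + 0)"
    by (intro tendsto_intros lim_const_over_n)
  then have "eventually (\<lambda>N. 2 * a * (2 * r + 5 / real N) < \<epsilon> / 2) sequentially"
    by (rule order_tendstoD) (use r in simp)
  moreover have "eventually (\<lambda>N. 2 / real N < d) sequentially"
    using lim_const_over_n[of "2::real"] d(1) by (rule order_tendstoD)
  moreover have "eventually (\<lambda>N. N \<ge> (1::nat)) sequentially"
    by (rule eventually_ge_at_top)
  ultimately have "eventually (\<lambda>N. norm ((\<Sum>k<N - 1. ?t N k) - 0) < \<epsilon>) sequentially"
  proof eventually_elim
    case (elim N)
    \<comment> \<open>The margin \<open>2\<close> covers the width of the stencil: for
      \<open>k\<close> outside \<open>Bad\<close> the whole interval from \<open>k / N\<close> to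
      \<open>(k + 2) / N\<close> lies in \<open>E\<close>.\<close>
    define Bad where "Bad = (\<Union>t\<in>T. {k::nat. \<bar>real k - t * N\<bar> < r * N + 2})"
    have "finite Bad"
      unfolding Bad_def using T r by (intro finite_UN_I card_nat_near) auto
    have "card Bad \<le> (\<Sum>t\<in>T. card {k::nat. \<bar>real k - t * N\<bar> < r * N + 2})"
      unfolding Bad_def by (rule card_UN_le[OF T])
    then have "real (card Bad) \<le> (\<Sum>t\<in>T. real (card {k::nat. \<bar>real k - t * N\<bar> < r * N + 2}))"
      by (simp flip: of_nat_sum)
    also have "\<dots> \<le> (\<Sum>t\<in>T. 2 * (r * N + 2) + 1)"
      using r by (intro sum_mono card_nat_near) auto
    finally have card_Bad: "real (card Bad) \<le> real (card T) * (2 * r * N + 5)"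
      by (simp add: algebra_simps)
    have "?t N k \<le> \<epsilon> / (2 * N) + 2 * L / N * of_bool (k \<in> Bad)" if k: "k < N - 1" for k
    proof (cases "k \<in> Bad")
      case True
      have "\<bar>\<beta> (real (j + 1) / N) - \<beta> (real j / N)\<bar> \<le> L / N" if "j \<le> k + 1" for j
      proof -
        have "dist (\<beta> (real (j + 1) / N)) (\<beta> (real j / N)) \<le> L * dist (real (j + 1) / N) (real j / N)"
          by (rule lipschitz_onD[OF lip]) (use that k in auto)
        also have "dist (real (j + 1) / N) (real j / N) = 1 / N"
          by (simp add: dist_real_def add_divide_distrib)
        finally show ?thesis by (simp add: dist_real_def)
      qed
      from this[of k] this[of "k + 1"] have "?t N k \<le> 2 * L / N"
        by (simp add: numeral_2_eq_2 add.commute)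
      moreover have "\<epsilon> / (2 * N) \<ge> 0"
        using \<epsilon> by simp
      ultimately show ?thesis using True by simp
    next
      case False
      have N: "real N > 0"
        using elim by simp
      have inE: "s \<in> E" if "real k / N \<le> s" "s \<le> real (k + 2) / N" for s
      proof -
        have "0 \<le> real k / N" "real (k + 2) / N \<le> 1"
          using k by auto
        then have "s \<in> {0..1}"
          using that by (meson atLeastAtMost_iff order_trans)
        moreover have "dist t s \<ge> r" if "t \<in> T" for t
        proof -
          have "r * N + 2 \<le> \<bar>real k - t * N\<bar>"
            using False that by (auto simp: Bad_def not_less)
          also have "\<dots> \<le> \<bar>s * N - t * N\<bar> + 2"
          proof -
            have "real k \<le> s * N" "s * N \<le> real k + 2"
              using \<open>real k / N \<le> s\<close> \<open>s \<le> real (k + 2) / N\<close> N by (auto simp: field_simps)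
            then show ?thesis by linarith
          qed
          also have "\<bar>s * N - t * N\<bar> = \<bar>s - t\<bar> * N"
            using N by (simp add: abs_mult flip: left_diff_distrib)
          finally have "r * N \<le> \<bar>s - t\<bar> * N" by simp
          then show ?thesis
            using N by (simp add: dist_real_def abs_minus_commute)
        qed
        ultimately show ?thesis
          by (auto simp: E_def not_less)
      qed
      have mvt: "\<exists>z. real j / N < z \<and> z < real (j + 1) / N \<and>
          \<beta> (real (j + 1) / N) - \<beta> (real j / N) = (1 / N) * D z" if "j = k \<or> j = k + 1" for j
      proof -
        have "real j / N < real (j + 1) / N"
          using N by (simp add: divide_strict_right_mono)
        then have "\<exists>z>real j / N. z < real (j + 1) / N \<and>
          \<beta> (real (j + 1) / N) - \<beta> (real j / N) = (real (j + 1) / N - real j / N) * D z"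
        proof (rule MVT2)
          fix s assume s: "real j / N \<le> s" "s \<le> real (j + 1) / N"
          have "real k / N \<le> real j / N" "real (j + 1) / N \<le> real (k + 2) / N"
            using that N by (auto intro!: divide_right_mono)
          with s have "s \<in> E"
            by (intro inE) linarith+
          then show "DERIV \<beta> s :> D s"
            using D[of s] ET by (auto simp: has_real_derivative_iff_has_vector_derivative)
        qed
        moreover have "real (j + 1) / N - real j / N = 1 / N"
          by (simp add: add_divide_distrib)
        ultimately show ?thesis by auto
      qed
      obtain z1 where z1: "real k / N < z1" "z1 < real (k + 1) / N"
        "\<beta> (real (k + 1) / N) - \<beta> (real k / N) = (1 / N) * D z1"
        using mvt[of k] by blast
      obtain z2 where z2: "real (k + 1) / N < z2" "z2 < real (k + 2) / N"
        "\<beta> (real (k + 2) / N) - \<beta> (real (k + 1) / N) = (1 / N) * D z2"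
        using mvt[of "k + 1"] by (auto simp: numeral_2_eq_2)
      have "real (k + 2) / N - real k / N = 2 / N"
        by (simp add: add_divide_distrib)
      then have "dist z2 z1 < d"
        using z1 z2 elim unfolding dist_real_def by linarith
      moreover have "z1 \<in> E" "z2 \<in> E"
        using z1 z2 by (auto intro!: inE)
      ultimately have "\<bar>D z2 - D z1\<bar> < \<epsilon> / 2"
        using d(2) by (simp add: dist_real_def)
      moreover have "?t N k = 1 / N * \<bar>D z2 - D z1\<bar>"
        unfolding z1(3) z2(3) using N by (simp add: abs_divide flip: diff_divide_distrib)
      moreover have "1 / N * \<bar>D z2 - D z1\<bar> \<le> 1 / N * (\<epsilon> / 2)"
        using calculation by (intro mult_left_mono) auto
      ultimately have "?t N k \<le> 1 / N * (\<epsilon> / 2)"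
        by linarith
      then show ?thesis
        using False by simp
    qed
    then have "(\<Sum>k<N - 1. ?t N k) \<le> (\<Sum>k<N - 1. \<epsilon> / (2 * N) + 2 * L / N * of_bool (k \<in> Bad))"
      by (intro sum_mono) auto
    also have "\<dots> = real (N - 1) * (\<epsilon> / (2 * N)) + 2 * L / N * real (card ({..<N - 1} \<inter> Bad))"
    proof -
      have "(\<Sum>k<N - 1. of_bool (k \<in> Bad)) = real (card ({..<N - 1} \<inter> Bad))"
        by (simp add: sum_of_bool_eq)
      then show ?thesis
        by (simp only: sum.distrib sum_distrib_left[symmetric] sum_constant card_lessThan)
    qed
    also have "\<dots> \<le> N * (\<epsilon> / (2 * N)) + 2 * L / N * (real (card T) * (2 * r * N + 5))"
    proof (intro add_mono mult_mono)
      show "real (card ({..<N - 1} \<inter> Bad)) \<le> real (card T) * (2 * r * N + 5)"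
        using card_mono[OF \<open>finite Bad\<close>, of "{..<N - 1} \<inter> Bad"] card_Bad by simp
    qed (use \<epsilon> L in auto)
    also have "\<dots> = \<epsilon> / 2 + 2 * a * (2 * r + 5 / N)"
      using elim by (simp add: a_def field_simps)
    also have "\<dots> < \<epsilon>"
      using elim by simp
    finally show ?case
      by (simp add: sum_nonneg)
  qed
  then show "\<exists>n0. \<forall>N\<ge>n0. norm ((\<Sum>k<N - 1. ?t N k) - 0) < \<epsilon>"
    by (simp add: eventually_sequentially)
qed

section \<open>Paths near a dissipative periodic orbit\<close>

definition concat_control :: "nat \<Rightarrow> (nat \<Rightarrow> 'u) \<Rightarrow> (nat \<Rightarrow> 'u) \<Rightarrow> nat \<Rightarrow> 'u" where
  "concat_control K u v k = (if k < K then u k else v (k - K))"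

lemma concat_control_simps [simp]:
  "k < K \<Longrightarrow> concat_control K u v k = u k"
  "concat_control K u v (K + k) = v k"
  by (auto simp: concat_control_def)

lemma traj_concat_control_le: "k \<le> K \<Longrightarrow> traj f (concat_control K u v) x k = traj f u x k"
  by (induction k) auto

lemma traj_concat_control_add:
  "traj f (concat_control K u v) x (K + k) = traj f v (traj f u x K) k"
  by (induction k) (auto simp: traj_concat_control_le)

lemma admissible_concat_control:
  assumes "u \<in> admissible f X U K x" "v \<in> admissible f X U M (traj f u x K)"
  shows "concat_control K u v \<in> admissible f X U (K + M) x"
proof -
  have "traj f (concat_control K u v) x k \<in> X" if "k \<le> K + M" for k
  proof (cases "k \<le> K")
    case True
    then show ?thesis using assms by (simp add: traj_concat_control_le admissible_def)
  next
    case False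
    then have "traj f v (traj f u x K) (k - K) \<in> X"
      using assms that by (simp add: admissible_def)
    then show ?thesis
      using False traj_concat_control_add[of f K u v x "k - K"] by simp
  qed
  then show ?thesis
    using assms by (auto simp: admissible_def concat_control_def)
qed

lemma admissible_mono: "u \<in> admissible f X U N x \<Longrightarrow> K \<le> N \<Longrightarrow> u \<in> admissible f X U K x"
  by (auto simp: admissible_def)

lemma sum_concat_control:
  fixes \<phi> :: "_ \<Rightarrow> real"
  shows "(\<Sum>k<K + M. \<phi> (traj f (concat_control K u v) x k, concat_control K u v k)) =
    (\<Sum>k<K. \<phi> (traj f u x k, u k)) + (\<Sum>k<M. \<phi> (traj f v (traj f u x K) k, v k))"
proof -
  let ?h = "\<lambda>k. \<phi> (traj f (concat_control K u v) x k, concat_control K u v k)"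
  have "sum ?h {..<K + M} = sum ?h {..<K} + sum ?h {K..<K + M}"
    using sum.atLeastLessThan_concat[of 0 K "K + M" ?h] by (simp only: lessThan_atLeast0 le_add1 zero_le)
  moreover have "sum ?h {K..<K + M} = (\<Sum>k<M. ?h (K + k))"
    using sum.shift_bounds_nat_ivl[of ?h 0 K M] by (simp add: lessThan_atLeast0 add.commute)
  ultimately show ?thesis
    by (simp add: traj_concat_control_le traj_concat_control_add)
qed

lemma sum_mod_shift:
  fixes h :: "nat \<Rightarrow> real"
  assumes "p > 0"
  shows "(\<Sum>i<p. h ((j + i) mod p)) = sum h {..<p}"
proof (induction j)
  case (Suc j)
  let ?H = "\<lambda>i. h ((j + i) mod p)"
  \<comment> \<open>Moving the window by one drops \<open>?H 0\<close> and gains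
    \<open>?H p\<close>, which coincide modulo \<open>p\<close>.\<close>
  have "sum ?H {..<p} + ?H p = ?H 0 + (\<Sum>i<p. ?H (Suc i))"
    using sum.lessThan_Suc[of ?H p] sum.lessThan_Suc_shift[of ?H p] by linarith
  then show ?case
    using Suc by simp
qed simp

text \<open>Abel summation; it moves the differences from the storage values onto the discount
  weights.\<close>

lemma sum_by_parts:
  fixes b g :: "nat \<Rightarrow> real"
  shows "(\<Sum>k<N. b k * (g (Suc k) - g k)) =
    b N * g N - b 0 * g 0 + (\<Sum>k<N. (b k - b (Suc k)) * g (Suc k))"
  by (induction N) (auto simp: algebra_simps)

section \<open>Rotated stage cost\<close>

locale periodic_dissipation =
  fixes f :: "'a::real_normed_vector \<times> 'b::real_normed_vector \<Rightarrow> 'a"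
    and l :: "'a \<times> 'b \<Rightarrow> real" and X :: "'a set" and U :: "'b set"
    and c :: real and p :: nat and orb :: "nat \<Rightarrow> 'a \<times> 'b"
    and lam :: "'a \<Rightarrow> real" and lam_bar :: real and \<alpha> :: "real \<Rightarrow> real"
  assumes cont_f: "continuous_on (X \<times> U) f"
    and cont_l: "continuous_on (X \<times> U) l"
    and cont_lam: "continuous_on X lam"
    and orbit: "periodic_orbit f X U p orb"
    and minimal: "minimal_orbit p orb"
    and lam_bound: "\<And>x. x \<in> X \<Longrightarrow> \<bar>lam x\<bar> \<le> lam_bar"
    and \<alpha>: "class_K_inf \<alpha>"
    and dissip: "\<And>x u. x \<in> X \<Longrightarrow> u \<in> admissible f X U 1 x \<Longrightarrow>
      l (x, u 0) - c + lam x - lam (f (x, u 0)) \<ge> \<alpha> (orbit_dist p orb (x, u 0))"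
    and average: "\<And>y. y \<in> X \<Longrightarrow> optimal_average f l X U y = ereal c"
begin

text \<open>The pairs to which the dissipation inequality applies; \<open>f z \<in> X\<close> makes
  \<open>lam (f z)\<close> a bounded and continuous quantity.\<close>

definition Dom :: "('a \<times> 'b) set" where
  "Dom = {z \<in> X \<times> U. f z \<in> X}"

text \<open>The rotated stage cost: along a path it differs from the shifted cost only by
  telescoping storage terms.\<close>

definition rot :: "'a \<times> 'b \<Rightarrow> real" where
  "rot z = l z - c + lam (fst z) - lam (f z)"

lemma p_pos: "p > 0"
  using orbit by (simp add: periodic_orbit_def)

lemma orb_succ: "j < p \<Longrightarrow> f (orb j) = fst (orb (Suc j mod p))"
  using orbit by (simp add: periodic_orbit_def)

lemma orb_Dom:
  assumes "j < p"
  shows "orb j \<in> Dom"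
proof -
  have "orb k \<in> X \<times> U" if "k < p" for k
    using orbit that by (simp add: periodic_orbit_def)
  from this[OF assms] this[OF mod_less_divisor[OF p_pos]] show ?thesis
    using orb_succ[OF assms] by (simp add: Dom_def mem_Times_iff)
qed

lemma orb_state: "j < p \<Longrightarrow> fst (orb j) \<in> X"
  using orb_Dom by (auto simp: Dom_def mem_Times_iff)

lemma orb_state_eqD: "j < p \<Longrightarrow> k < p \<Longrightarrow> fst (orb j) = fst (orb k) \<Longrightarrow> j = k"
  using minimal by (auto simp: minimal_orbit_def)

lemma cont_f_Dom: "continuous_on Dom f"
  using cont_f by (rule continuous_on_subset) (auto simp: Dom_def)

lemma cont_lam_f: "continuous_on Dom (\<lambda>z. lam (f z))"
  by (rule continuous_on_compose2[OF cont_lam cont_f_Dom]) (auto simp: Dom_def)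

lemma cont_rot: "continuous_on Dom rot"
proof -
  have "continuous_on Dom l"
    using cont_l by (rule continuous_on_subset) (auto simp: Dom_def)
  moreover have "continuous_on Dom (\<lambda>z. lam (fst z))"
    by (rule continuous_on_compose2[OF cont_lam]) (auto simp: Dom_def intro: continuous_intros)
  ultimately show ?thesis
    unfolding rot_def[abs_def] by (intro continuous_intros cont_lam_f)
qed

lemma \<alpha>_nonneg: "t \<ge> 0 \<Longrightarrow> \<alpha> t \<ge> 0"
  using \<alpha> by (auto simp: class_K_inf_def)

lemma \<alpha>_mono: "0 \<le> s \<Longrightarrow> s \<le> t \<Longrightarrow> \<alpha> s \<le> \<alpha> t"
  using \<alpha> by (auto simp: class_K_inf_def strict_mono_on_leD)

lemma \<alpha>_pos: "t > 0 \<Longrightarrow> \<alpha> t > 0"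
  using \<alpha> strict_mono_onD[of "{0..}" \<alpha> 0 t] by (auto simp: class_K_inf_def)

lemma orbit_dist_less_iff: "orbit_dist p orb z < \<delta> \<longleftrightarrow> (\<exists>j<p. norm (z - orb j) < \<delta>)"
  using p_pos unfolding orbit_dist_def by (subst Min_less_iff) auto

lemma orbit_dist_nonneg: "orbit_dist p orb z \<ge> 0"
  using p_pos unfolding orbit_dist_def by (subst Min_ge_iff) auto

lemma rot_ge: "z \<in> Dom \<Longrightarrow> rot z \<ge> \<alpha> (orbit_dist p orb z)"
  \<comment> \<open>An admissible sequence of length \<open>1\<close> is constrained only at index
    \<open>0\<close>, so a constant sequence may represent the input.\<close>
  using dissip[of "fst z" "\<lambda>_. snd z"]
  by (auto simp: Dom_def rot_def admissible_def le_Suc_eq)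

lemma rot_nonneg: "z \<in> Dom \<Longrightarrow> rot z \<ge> 0"
  using rot_ge[of z] \<alpha>_nonneg[OF orbit_dist_nonneg[of z]] by linarith

lemma rot_ge_far: "z \<in> Dom \<Longrightarrow> 0 \<le> \<delta> \<Longrightarrow> \<delta> \<le> orbit_dist p orb z \<Longrightarrow> rot z \<ge> \<alpha> \<delta>"
  using rot_ge[of z] \<alpha>_mono[of \<delta> "orbit_dist p orb z"] by linarith

lemma admissible_Dom:
  assumes "u \<in> admissible f X U N x" "k < N"
  shows "(traj f u x k, u k) \<in> Dom"
proof -
  have "traj f u x (Suc k) \<in> X"
    using assms unfolding admissible_def by (metis (mono_tags, lifting) Suc_leI mem_Collect_eq)
  then show ?thesis
    using assms by (auto simp: Dom_def admissible_def)
qed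

section \<open>Phase of a path near the orbit\<close>

text \<open>The orbit has finitely many points, so the radii from pointwise continuity have a common
  positive choice; properties holding eventually at \<open>0\<close> from the right are closed under
  finite conjunction.\<close>

lemma continuous_near_orbit:
  fixes \<phi> :: "'a \<times> 'b \<Rightarrow> 'c::metric_space"
  assumes "continuous_on Dom \<phi>" "\<eta> > 0"
  shows "\<exists>\<delta>>0. \<forall>z\<in>Dom. \<forall>j<p. norm (z - orb j) < \<delta> \<longrightarrow> dist (\<phi> z) (\<phi> (orb j)) < \<eta>"
proof -
  have "eventually (\<lambda>\<delta>. \<forall>z\<in>Dom. norm (z - orb j) < \<delta> \<longrightarrow> dist (\<phi> z) (\<phi> (orb j)) < \<eta>) (at_right 0)"
    if j: "j \<in> {..<p}" for j
  proof -
    obtain d where "d > 0" "\<forall>z\<in>Dom. dist z (orb j) < d \<longrightarrow> dist (\<phi> z) (\<phi> (orb j)) < \<eta>"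
      using assms orb_Dom[of j] j unfolding continuous_on_iff by fastforce
    then show ?thesis
      by (intro eventually_at_rightI[of 0 d]) (force simp: dist_norm)+
  qed
  then have "eventually (\<lambda>\<delta>. \<forall>j\<in>{..<p}. \<forall>z\<in>Dom. norm (z - orb j) < \<delta> \<longrightarrow> dist (\<phi> z) (\<phi> (orb j)) < \<eta>)
      (at_right 0)"
    by (intro eventually_ball_finite) auto
  moreover have "eventually (\<lambda>\<delta>::real. \<delta> > 0) (at_right 0)"
    by (rule eventually_at_right_less)
  ultimately have "eventually (\<lambda>\<delta>. \<delta> > 0 \<and> (\<forall>j\<in>{..<p}. \<forall>z\<in>Dom.
      norm (z - orb j) < \<delta> \<longrightarrow> dist (\<phi> z) (\<phi> (orb j)) < \<eta>)) (at_right 0)"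
    by eventually_elim simp
  from eventually_happens'[OF _ this] show ?thesis
    by (auto simp: trivial_limit_at_right_real)
qed

text \<open>Minimality of the orbit enters here: it determines the phase of a nearby point from its state.\<close>

lemma orbit_phase_step:
  "\<exists>\<delta>>0. \<forall>z\<in>Dom. \<forall>z'. \<forall>j<p. \<forall>j'<p. norm (z - orb j) < \<delta> \<longrightarrow> norm (z' - orb j') < \<delta> \<longrightarrow>
    fst z' = f z \<longrightarrow> j' = Suc j mod p"
proof -
  define R where "R = (\<lambda>(j, k). norm (fst (orb j) - fst (orb k))) ` {(j, k). j < p \<and> k < p \<and> j \<noteq> k}"
  have "finite R"
    unfolding R_def by (rule finite_imageI, rule finite_subset[of _ "{..<p} \<times> {..<p}"]) auto
  moreover have "0 < s" if "s \<in> R" for s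
    using that orb_state_eqD by (auto simp: R_def)
  \<comment> \<open>The smallest gap between distinct orbit states; \<open>insert 1\<close> handles
    \<open>p = 1\<close>, where there are no gaps. A state closer than \<open>r / 2\<close> to two
    orbit states forces them to be equal.\<close>
  moreover define r where "r = Min (insert 1 R)"
  ultimately have r: "r > 0" "\<And>s. s \<in> R \<Longrightarrow> r \<le> s"
    by auto
  obtain d where d: "d > 0"
    "\<And>z j. z \<in> Dom \<Longrightarrow> j < p \<Longrightarrow> norm (z - orb j) < d \<Longrightarrow> dist (f z) (f (orb j)) < r / 2"
    using continuous_near_orbit[OF cont_f_Dom, of "r / 2"] r by auto
  have "j' = Suc j mod p" if "z \<in> Dom" "j < p" "j' < p" "norm (z - orb j) < min d (r / 2)"
    "norm (z' - orb j') < min d (r / 2)" "fst z' = f z" for z z' j j'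
  proof (rule ccontr)
    assume ne: "j' \<noteq> Suc j mod p"
    have "norm (f z - fst (orb j')) < r / 2"
      using norm_fst_le[of "fst z' - fst (orb j')" "snd z' - snd (orb j')"] that
      by (cases z'; cases "orb j'") auto
    moreover have "norm (f z - fst (orb (Suc j mod p))) < r / 2"
      using d(2)[of z j] that orb_succ[of j] by (auto simp: dist_norm)
    ultimately have "norm (fst (orb (Suc j mod p)) - fst (orb j')) < r"
      using norm_triangle_ineq4[of "f z - fst (orb j')" "f z - fst (orb (Suc j mod p))"] by simp
    moreover have "norm (fst (orb (Suc j mod p)) - fst (orb j')) \<in> R"
      unfolding R_def using ne that p_pos by (intro image_eqI[of _ _ "(Suc j mod p, j')"]) auto
    ultimately show False
      using r(2) by (metis not_less)
  qed
  then show ?thesis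
    using d(1) r(1) by (intro exI[of _ "min d (r / 2)"]) auto
qed

text \<open>Chaining the phase step by induction on the window length: each step near the orbit
  advances the phase by exactly one, so a single starting phase describes the whole window. Taking
  \<open>\<delta>'\<close> below the radius of the phase step makes the nearby orbit point
  unambiguous.\<close>

lemma orbit_phase:
  assumes "0 < \<delta>"
  shows "\<exists>\<delta>'>0. \<delta>' \<le> \<delta> \<and> (\<forall>u x N a m. u \<in> admissible f X U N x \<longrightarrow> a + m \<le> N \<longrightarrow>
    (\<forall>k\<in>{a..<a + m}. orbit_dist p orb (traj f u x k, u k) < \<delta>') \<longrightarrow>
    (\<exists>j. \<forall>i<m. norm ((traj f u x (a + i), u (a + i)) - orb ((j + i) mod p)) < \<delta>'))"
proof -
  obtain d where d: "d > 0" "\<And>z z' j j'. z \<in> Dom \<Longrightarrow> j < p \<Longrightarrow> j' < p \<Longrightarrow> norm (z - orb j) < d \<Longrightarrow>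
      norm (z' - orb j') < d \<Longrightarrow> fst z' = f z \<Longrightarrow> j' = Suc j mod p"
    using orbit_phase_step by meson
  define \<delta>' where "\<delta>' = min d \<delta>"
  have "\<exists>j. \<forall>i<m. norm ((traj f u x (a + i), u (a + i)) - orb ((j + i) mod p)) < \<delta>'"
    if u: "u \<in> admissible f X U N x" and N: "a + m \<le> N"
      and close: "\<forall>k\<in>{a..<a + m}. orbit_dist p orb (traj f u x k, u k) < \<delta>'" for u x N a m
    using N close
  proof (induction m)
    case (Suc m)
    then obtain j where j: "\<forall>i<m. norm ((traj f u x (a + i), u (a + i)) - orb ((j + i) mod p)) < \<delta>'"
      by auto
    have "orbit_dist p orb (traj f u x (a + m), u (a + m)) < \<delta>'"
      using Suc by auto
    then obtain j' where j': "j' < p" "norm ((traj f u x (a + m), u (a + m)) - orb j') < \<delta>'"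
      by (auto simp: orbit_dist_less_iff)
    show ?case
    proof (cases m)
      case 0
      then show ?thesis using j' by (intro exI[of _ j']) auto
    next
      case (Suc n)
      have "j' = Suc ((j + n) mod p) mod p"
      proof (rule d(2))
        show "(traj f u x (a + n), u (a + n)) \<in> Dom"
          using admissible_Dom[OF u] Suc.prems Suc by simp
        show "norm ((traj f u x (a + n), u (a + n)) - orb ((j + n) mod p)) < d"
          using j Suc by (simp add: \<delta>'_def)
        show "norm ((traj f u x (a + m), u (a + m)) - orb j') < d"
          using j' by (simp add: \<delta>'_def)
      qed (use j' p_pos Suc in auto)
      then have "j' = (j + m) mod p"
        using Suc by (simp add: mod_Suc_eq)
      then have "\<forall>i<Suc m. norm ((traj f u x (a + i), u (a + i)) - orb ((j + i) mod p)) < \<delta>'"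
        using j j' by (auto simp: less_Suc_eq)
      then show ?thesis by blast
    qed
  qed simp
  then show ?thesis
    using d(1) assms by (intro exI[of _ \<delta>']) (auto simp: \<delta>'_def)
qed

section \<open>Vanishing of the rotated cost on the orbit\<close>

lemma lam_bar_nonneg: "lam_bar \<ge> 0"
  using lam_bound[OF orb_state[OF p_pos]] by linarith

lemma sum_rot:
  "(\<Sum>k<N. rot (traj f u x k, u k)) = (\<Sum>k<N. l (traj f u x k, u k) - c) + lam x - lam (traj f u x N)"
  by (induction N) (auto simp: rot_def)

text \<open>If \<open>rot\<close> were positive at one orbit point, every block of \<open>p\<close>
  steps would cost at least some \<open>\<theta> > 0\<close>: a block that stays close passes near
  that point, and any other block has a step far from the orbit. Boundedness of \<open>lam\<close>
  then keeps the average cost away from \<open>c\<close>.\<close>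

lemma rot_orb_zero:
  assumes j0: "j0 < p"
  shows "rot (orb j0) = 0"
proof (rule ccontr)
  define a where "a = rot (orb j0)"
  assume "rot (orb j0) \<noteq> 0"
  then have a: "a > 0"
    using rot_nonneg[OF orb_Dom[OF j0]] by (simp add: a_def)
  obtain \<delta> where \<delta>: "\<delta> > 0"
    "\<And>z j. z \<in> Dom \<Longrightarrow> j < p \<Longrightarrow> norm (z - orb j) < \<delta> \<Longrightarrow> dist (rot z) (rot (orb j)) < a / 2"
    using continuous_near_orbit[OF cont_rot, of "a / 2"] a by auto
  obtain \<delta>' where \<delta>': "\<delta>' > 0" "\<delta>' \<le> \<delta>"
    and phase: "\<And>u x N k m. u \<in> admissible f X U N x \<Longrightarrow> k + m \<le> N \<Longrightarrow>
      \<forall>i\<in>{k..<k + m}. orbit_dist p orb (traj f u x i, u i) < \<delta>' \<Longrightarrow>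
      \<exists>j. \<forall>i<m. norm ((traj f u x (k + i), u (k + i)) - orb ((j + i) mod p)) < \<delta>'"
    using orbit_phase[OF \<delta>(1)] by metis
  define \<theta> where "\<theta> = min (a / 2) (\<alpha> \<delta>')"
  have \<theta>: "\<theta> > 0"
    using a \<alpha>_pos[OF \<delta>'(1)] by (simp add: \<theta>_def)
  have block: "\<theta> \<le> (\<Sum>i = k..<k + p. rot (traj f u x i, u i))"
    if u: "u \<in> admissible f X U N x" and N: "k + p \<le> N" for u x N k
  proof -
    have D: "(traj f u x i, u i) \<in> Dom" if "i \<in> {k..<k + p}" for i
      using admissible_Dom[OF u] that N by auto
    have "\<exists>i\<in>{k..<k + p}. \<theta> \<le> rot (traj f u x i, u i)"
    proof (cases "\<forall>i\<in>{k..<k + p}. orbit_dist p orb (traj f u x i, u i) < \<delta>'")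
      case True
      then obtain j where j: "\<And>i. i < p \<Longrightarrow>
          norm ((traj f u x (k + i), u (k + i)) - orb ((j + i) mod p)) < \<delta>'"
        using phase[OF u N] by auto
      \<comment> \<open>The offset at which the starting phase \<open>j\<close> reaches
        \<open>j0\<close>; \<open>p - j mod p\<close> stands for \<open>- j\<close> within the
        natural numbers.\<close>
      define i where "i = (j0 + (p - j mod p)) mod p"
      have "(j + i) mod p = (j mod p + (j0 + (p - j mod p))) mod p"
        unfolding i_def by (simp add: mod_add_left_eq mod_add_right_eq)
      also have "j mod p + (j0 + (p - j mod p)) = j0 + p"
        using mod_less_divisor[OF p_pos, of j] by linarith
      also have "(j0 + p) mod p = j0"
        using j0 by simp
      finally have "(j + i) mod p = j0" .
      moreover have i: "i < p"
        using p_pos by (simp add: i_def)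
      ultimately have "norm ((traj f u x (k + i), u (k + i)) - orb j0) < \<delta>"
        using j[of i] \<delta>' by simp
      then have "dist (rot (traj f u x (k + i), u (k + i))) a < a / 2"
        unfolding a_def[symmetric] using \<delta>(2)[OF D[of "k + i"] j0] i by (simp add: a_def)
      then have "a / 2 \<le> rot (traj f u x (k + i), u (k + i))"
        unfolding dist_real_def by linarith
      then show ?thesis
        using i by (intro bexI[of _ "k + i"]) (auto simp: \<theta>_def)
    next
      case False
      then obtain i where "i \<in> {k..<k + p}" "\<delta>' \<le> orbit_dist p orb (traj f u x i, u i)"
        by (meson not_less)
      then show ?thesis
        using rot_ge_far[OF D, of i \<delta>'] \<delta>' by (intro bexI[of _ i]) (auto simp: \<theta>_def)
    qed
    then obtain i where i: "i \<in> {k..<k + p}" "\<theta> \<le> rot (traj f u x i, u i)"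
      by blast
    note i(2)
    also have "rot (traj f u x i, u i) \<le> (\<Sum>i = k..<k + p. rot (traj f u x i, u i))"
      using i(1) D rot_nonneg by (intro member_le_sum) auto
    finally show ?thesis .
  qed
  define x where "x = fst (orb 0)"
  have x: "x \<in> X"
    using orb_state p_pos by (simp add: x_def)
  \<comment> \<open>Half of the excess \<open>\<theta> / p\<close> per step that the blocks
    enforce.\<close>
  define \<epsilon> where "\<epsilon> = \<theta> / (2 * real p)"
  have \<epsilon>: "\<epsilon> > 0"
    using \<theta> p_pos by (simp add: \<epsilon>_def)
  then have "optimal_average f l X U x < ereal (c + \<epsilon>)"
    using average[OF x] by simp
  then obtain u where u: "u \<in> admissible_inf f X U x"
    and liminf: "liminf (\<lambda>N. ereal ((1 / real N) * (\<Sum>k<N. l (traj f u x k, u k)))) < ereal (c + \<epsilon>)"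
    unfolding optimal_average_def by (auto simp: INF_less_iff)
  \<comment> \<open>Even after granting the average excess \<open>\<epsilon>\<close>,
    \<open>q\<close> blocks leave a surplus of \<open>(q - 1) * \<theta> / 2\<close>, of which the
    storage absorbs at most \<open>2 * lam_bar\<close>; the bound on \<open>q0\<close> makes this
    impossible.\<close>
  obtain q0 :: nat where q0: "real q0 > 1 + 4 * lam_bar / \<theta>"
    using reals_Archimedean2 by blast
  \<comment> \<open>An eventual lower bound would pass to the liminf; hence the average is below
    \<open>c + \<epsilon>\<close> for arbitrarily large \<open>N\<close>.\<close>
  have "\<not> eventually (\<lambda>N. ereal (c + \<epsilon>) \<le> ereal ((1 / real N) * (\<Sum>k<N. l (traj f u x k, u k)))) sequentially"
  proof
    assume "eventually (\<lambda>N. ereal (c + \<epsilon>) \<le> ereal ((1 / real N) * (\<Sum>k<N. l (traj f u x k, u k)))) sequentially"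
    from leD[OF Liminf_bounded[OF this]] show False
      using liminf by contradiction
  qed
  then obtain N where N: "N \<ge> Suc (q0 * p)"
    and avg: "(1 / real N) * (\<Sum>k<N. l (traj f u x k, u k)) < c + \<epsilon>"
    unfolding eventually_sequentially by (auto simp: not_le)
  have uN: "u \<in> admissible f X U N x"
    using u by (auto simp: admissible_def admissible_inf_def)
  define q where "q = N div p"
  have "N = q * p + N mod p" "N mod p < p"
    using p_pos by (auto simp: q_def)
  then have qN: "q * p \<le> N" "N \<le> (q + 1) * p"
    by auto
  have "(q0 * p) div p \<le> q"
    unfolding q_def using N by (intro div_le_mono) auto
  then have "q0 \<le> q"
    using p_pos by simp
  with q0 have q: "real q > 1 + 4 * lam_bar / \<theta>"
    by linarith
  have "real q * \<theta> = (\<Sum>m<q. \<theta>)"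
    by simp
  also have "\<dots> \<le> (\<Sum>m<q. \<Sum>i = m * p..<m * p + p. rot (traj f u x i, u i))"
  proof (rule sum_mono)
    fix m assume "m \<in> {..<q}"
    then have "(m + 1) * p \<le> q * p"
      by (intro mult_right_mono) auto
    then show "\<theta> \<le> (\<Sum>i = m * p..<m * p + p. rot (traj f u x i, u i))"
      using qN by (intro block[OF uN]) auto
  qed
  also have "\<dots> = (\<Sum>i<q * p. rot (traj f u x i, u i))"
    by (rule sum.nat_group)
  also have "\<dots> \<le> (\<Sum>i<N. rot (traj f u x i, u i))"
    using qN rot_nonneg admissible_Dom[OF uN] by (intro sum_mono2) auto
  also have "\<dots> = (\<Sum>k<N. l (traj f u x k, u k)) - N * c + lam x - lam (traj f u x N)"
    by (simp add: sum_rot sum_subtractf)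
  also have "(\<Sum>k<N. l (traj f u x k, u k)) \<le> N * (c + \<epsilon>)"
    using avg N by (simp add: field_simps)
  also have "N * (c + \<epsilon>) = N * c + N * \<epsilon>"
    by (simp add: algebra_simps)
  also have "N * \<epsilon> \<le> (real q + 1) * p * \<epsilon>"
  proof (rule mult_right_mono)
    have "real N \<le> real ((q + 1) * p)"
      using qN(2) by (rule of_nat_mono)
    then show "real N \<le> (real q + 1) * p"
      by (simp add: distrib_right)
  qed (use \<epsilon> in simp)
  also have "(real q + 1) * p * \<epsilon> = (real q + 1) * (\<theta> / 2)"
    using p_pos by (simp add: \<epsilon>_def)
  finally have "real q * \<theta> \<le> (real q + 1) * (\<theta> / 2) + lam x - lam (traj f u x N)"
    by simp
  moreover have "traj f u x N \<in> X"
    using uN by (simp add: admissible_def)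
  then have "lam x - lam (traj f u x N) \<le> 2 * lam_bar"
    using lam_bound[OF x] lam_bound[of "traj f u x N"] by (simp add: abs_le_iff)
  ultimately have "real q * \<theta> \<le> \<theta> + 4 * lam_bar"
    by (simp add: field_simps)
  moreover have "\<theta> + 4 * lam_bar < real q * \<theta>"
    using q \<theta> by (simp add: field_simps)
  ultimately show False by linarith
qed

section \<open>Following the orbit and averaging the storage function\<close>

definition orbit_control :: "nat \<Rightarrow> nat \<Rightarrow> 'b" where
  "orbit_control j k = snd (orb ((j + k) mod p))"

lemma traj_orbit_control:
  "j < p \<Longrightarrow> traj f (orbit_control j) (fst (orb j)) k = fst (orb ((j + k) mod p))"
proof (induction k)
  case (Suc k)
  then have "traj f (orbit_control j) (fst (orb j)) (Suc k) = f (orb ((j + k) mod p))"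
    by (simp add: Suc.IH) (simp add: orbit_control_def)
  then show ?case
    using p_pos by (simp add: orb_succ mod_Suc_eq)
qed simp

lemma orbit_control_admissible:
  assumes "j < p"
  shows "orbit_control j \<in> admissible f X U N (fst (orb j))"
proof -
  have "orb ((j + k) mod p) \<in> X \<times> U" for k
    using orb_Dom[of "(j + k) mod p"] p_pos by (simp add: Dom_def)
  then show ?thesis
    using assms by (auto simp: admissible_def traj_orbit_control orbit_control_def mem_Times_iff)
qed

lemma rot_orbit_control:
  "j < p \<Longrightarrow> rot (traj f (orbit_control j) (fst (orb j)) k, orbit_control j k) = 0"
  using p_pos by (simp add: traj_orbit_control orbit_control_def rot_orb_zero)

definition lam_avg :: real where
  "lam_avg = (\<Sum>j<p. lam (fst (orb j))) / p"

lemma lam_avg_bound: "\<bar>lam_avg\<bar> \<le> lam_bar"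
proof -
  have "\<bar>\<Sum>j<p. lam (fst (orb j))\<bar> \<le> (\<Sum>j<p. lam_bar)"
    by (rule order_trans[OF sum_abs sum_mono]) (use lam_bound orb_state in auto)
  then show ?thesis
    using p_pos by (simp add: lam_avg_def field_simps)
qed

text \<open>A block without steps far from the orbit runs once through all phases, so its storage
  values match the orbit values up to \<open>\<eta>\<close> each. A block with such a step gets the
  crude bound \<open>2 * lam_bar\<close> per term, paid for by the count of far steps.\<close>

lemma block_sum_lam:
  assumes "\<eta> > 0"
  shows "\<exists>\<delta>>0. \<forall>u x N a. u \<in> admissible f X U N x \<longrightarrow> a + p \<le> N \<longrightarrow>
    \<bar>\<Sum>k = a..<a + p. lam (traj f u x (Suc k)) - lam_avg\<bar> \<le>
      real p * \<eta> + real p * (2 * lam_bar) *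
        (\<Sum>k = a..<a + p. of_bool (\<delta> \<le> orbit_dist p orb (traj f u x k, u k)))"
proof -
  \<comment> \<open>The storage is evaluated one step after the pair known to be near the orbit,
    hence continuity of \<open>lam\<close> after \<open>f\<close>, and below the phase
    \<open>Suc j\<close>.\<close>
  obtain \<delta> where \<delta>: "\<delta> > 0"
    "\<And>z j. z \<in> Dom \<Longrightarrow> j < p \<Longrightarrow> norm (z - orb j) < \<delta> \<Longrightarrow> dist (lam (f z)) (lam (f (orb j))) < \<eta>"
    using continuous_near_orbit[OF cont_lam_f assms] by auto
  obtain \<delta>' where \<delta>': "\<delta>' > 0" "\<delta>' \<le> \<delta>"
    and phase: "\<And>u x N k m. u \<in> admissible f X U N x \<Longrightarrow> k + m \<le> N \<Longrightarrow>
      \<forall>i\<in>{k..<k + m}. orbit_dist p orb (traj f u x i, u i) < \<delta>' \<Longrightarrow>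
      \<exists>j. \<forall>i<m. norm ((traj f u x (k + i), u (k + i)) - orb ((j + i) mod p)) < \<delta>'"
    using orbit_phase[OF \<delta>(1)] by metis
  have "\<bar>\<Sum>k = a..<a + p. lam (traj f u x (Suc k)) - lam_avg\<bar> \<le>
      real p * \<eta> + real p * (2 * lam_bar) *
        (\<Sum>k = a..<a + p. of_bool (\<delta>' \<le> orbit_dist p orb (traj f u x k, u k)))" (is "?lhs \<le> _ + _ * ?bad")
    if u: "u \<in> admissible f X U N x" and N: "a + p \<le> N" for u x N a
  proof -
    have D: "(traj f u x i, u i) \<in> Dom" if "i \<in> {a..<a + p}" for i
      using admissible_Dom[OF u] that N by auto
    show ?thesis
    proof (cases "\<forall>i\<in>{a..<a + p}. orbit_dist p orb (traj f u x i, u i) < \<delta>'")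
      case True
      then obtain j where j: "\<And>i. i < p \<Longrightarrow>
          norm ((traj f u x (a + i), u (a + i)) - orb ((j + i) mod p)) < \<delta>'"
        using phase[OF u N] by auto
      have "real p * lam_avg = (\<Sum>i<p. lam (fst (orb i)))"
        using p_pos by (simp add: lam_avg_def)
      also have "\<dots> = (\<Sum>i<p. lam (fst (orb ((Suc j + i) mod p))))"
        by (rule sum_mod_shift[OF p_pos, symmetric])
      finally have avg: "real p * lam_avg = (\<Sum>i<p. lam (fst (orb ((Suc j + i) mod p))))" .
      have "(\<Sum>k = a..<a + p. lam (traj f u x (Suc k)) - lam_avg)
          = (\<Sum>i<p. lam (traj f u x (Suc (a + i))) - lam_avg)"
        using sum.shift_bounds_nat_ivl[of "\<lambda>k. lam (traj f u x (Suc k)) - lam_avg" 0 a p]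
        by (simp add: lessThan_atLeast0 add.commute)
      also have "\<dots> = (\<Sum>i<p. lam (traj f u x (Suc (a + i))) - lam (fst (orb ((Suc j + i) mod p))))"
        by (simp add: sum_subtractf avg)
      also have "\<bar>\<dots>\<bar> \<le> (\<Sum>i<p. \<eta>)"
      proof (rule order_trans[OF sum_abs sum_mono])
        fix i assume "i \<in> {..<p}"
        then have "dist (lam (f (traj f u x (a + i), u (a + i)))) (lam (f (orb ((j + i) mod p)))) < \<eta>"
          using j[of i] \<delta>' p_pos by (intro \<delta>(2) D) auto
        moreover have "f (orb ((j + i) mod p)) = fst (orb ((Suc j + i) mod p))"
          using p_pos by (simp add: orb_succ mod_Suc_eq)
        ultimately show "\<bar>lam (traj f u x (Suc (a + i))) - lam (fst (orb ((Suc j + i) mod p)))\<bar> \<le> \<eta>"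
          by (simp add: dist_real_def)
      qed
      finally have "?lhs \<le> real p * \<eta>"
        by simp
      moreover have "0 \<le> real p * (2 * lam_bar) * ?bad"
        using lam_bar_nonneg by (intro mult_nonneg_nonneg sum_nonneg) auto
      ultimately show ?thesis by linarith
    next
      case False
      then obtain i where i: "i \<in> {a..<a + p}" "\<delta>' \<le> orbit_dist p orb (traj f u x i, u i)"
        by (meson not_less)
      have "?lhs \<le> (\<Sum>k = a..<a + p. 2 * lam_bar)"
      proof (rule order_trans[OF sum_abs sum_mono])
        fix k assume "k \<in> {a..<a + p}"
        then have "traj f u x (Suc k) \<in> X"
          using D[of k] by (simp add: Dom_def)
        then show "\<bar>lam (traj f u x (Suc k)) - lam_avg\<bar> \<le> 2 * lam_bar"
          using lam_bound lam_avg_bound by fastforce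
      qed
      also have "\<dots> = real p * (2 * lam_bar) * 1"
        by simp
      also have "\<dots> \<le> real p * (2 * lam_bar) * ?bad"
      proof (rule mult_left_mono)
        have "of_bool (\<delta>' \<le> orbit_dist p orb (traj f u x i, u i)) \<le> ?bad"
          using i(1) by (intro member_le_sum) auto
        then show "1 \<le> ?bad"
          using i(2) by simp
      qed (use lam_bar_nonneg in simp)
      finally show ?thesis
        using assms by (smt (verit) mult_nonneg_nonneg of_nat_0_le_iff)
    qed
  qed
  then show ?thesis
    using \<delta>'(1) by blast
qed

end

section \<open>Convergence of the discounted value function\<close>

locale discounted_problem = periodic_dissipation +
  fixes \<beta> :: "real \<Rightarrow> real" and L \<kappa> :: real and x
  assumes discount: "discount_function \<beta>"
    and lipschitz: "L-lipschitz_on {0..1} \<beta>"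
    and controllable: "locally_controllable f X U p orb \<kappa>"
    and reachable: "finite_time_reachable f X U p orb \<kappa>"
    and x: "x \<in> X"
begin

lemma \<beta>_0 [simp]: "\<beta> 0 = 1" and \<beta>_1 [simp]: "\<beta> 1 = 0"
  using discount by (auto simp: discount_function_def)

lemma \<beta>_antimono: "0 \<le> s \<Longrightarrow> s \<le> t \<Longrightarrow> t \<le> 1 \<Longrightarrow> \<beta> t \<le> \<beta> s"
  using discount by (auto simp: discount_function_def monotone_on_def)

lemma \<beta>_nonneg: "0 \<le> t \<Longrightarrow> t \<le> 1 \<Longrightarrow> 0 \<le> \<beta> t" and \<beta>_le_1: "0 \<le> t \<Longrightarrow> t \<le> 1 \<Longrightarrow> \<beta> t \<le> 1"
  using discount by (auto simp: discount_function_def Pi_iff)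

lemma L_nonneg: "L \<ge> 0"
  using lipschitz by (rule lipschitz_on_nonneg)

section \<open>Splitting of the discounted cost\<close>

definition rot_cost :: "nat \<Rightarrow> (nat \<Rightarrow> 'b) \<Rightarrow> real" where
  "rot_cost N u = (\<Sum>k<N. rot (traj f u x k, u k))"

definition disc_rot_cost :: "nat \<Rightarrow> (nat \<Rightarrow> 'b) \<Rightarrow> real" where
  "disc_rot_cost N u = (\<Sum>k<N. \<beta> (real k / real N) * rot (traj f u x k, u k))"

text \<open>The term \<open>R\<^sub>N\<close> of the overview: what summation by parts leaves of the
  storage differences.\<close>

definition disc_storage :: "nat \<Rightarrow> (nat \<Rightarrow> 'b) \<Rightarrow> real" where
  "disc_storage N u =
    (\<Sum>k<N. (\<beta> (real k / real N) - \<beta> (real (k + 1) / real N)) * lam (traj f u x (Suc k)))"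

definition connecting :: "(nat \<times> (nat \<Rightarrow> 'b)) set" where
  "connecting = {(K, u). u \<in> admissible f X U K x \<and> (\<exists>j<p. traj f u x K = fst (orb j))}"

text \<open>A real infimum, well behaved because \<open>connecting\<close> is nonempty and rotated
  costs are nonnegative, both shown below.\<close>

definition transfer_cost :: real where
  "transfer_cost = (INF (K, u) \<in> connecting. rot_cost K u)"

lemma rot_cost_nonneg: "u \<in> admissible f X U N x \<Longrightarrow> 0 \<le> rot_cost N u"
  unfolding rot_cost_def using rot_nonneg admissible_Dom by (intro sum_nonneg) auto

lemma disc_rot_cost_le:
  assumes "u \<in> admissible f X U N x"
  shows "disc_rot_cost N u \<le> rot_cost N u"
  unfolding disc_rot_cost_def rot_cost_def
proof (rule sum_mono)
  fix k assume k: "k \<in> {..<N}"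
  then have "\<beta> (real k / real N) \<le> 1" "0 \<le> rot (traj f u x k, u k)"
    using rot_nonneg admissible_Dom[OF assms] by (auto intro!: \<beta>_le_1)
  then show "\<beta> (real k / real N) * rot (traj f u x k, u k) \<le> rot (traj f u x k, u k)"
    using mult_right_mono by fastforce
qed

lemma sum_weights: "N \<ge> 1 \<Longrightarrow> (\<Sum>k<N. \<beta> (real k / real N) - \<beta> (real (k + 1) / real N)) = 1"
  using sum_lessThan_telescope'[of "\<lambda>k. \<beta> (real k / real N)" N] by simp

lemma weight_bounds:
  assumes "k < N"
  shows "0 \<le> \<beta> (real k / real N) - \<beta> (real (k + 1) / real N)"
    "\<beta> (real k / real N) - \<beta> (real (k + 1) / real N) \<le> L / N"
proof -
  have k: "0 \<le> real k / N" "real k / N \<le> real (k + 1) / N" "real (k + 1) / N \<le> 1"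
    using assms by (auto intro!: divide_right_mono)
  then show "0 \<le> \<beta> (real k / real N) - \<beta> (real (k + 1) / real N)"
    using \<beta>_antimono by simp
  have "dist (\<beta> (real k / N)) (\<beta> (real (k + 1) / N)) \<le> L * dist (real k / N) (real (k + 1) / N)"
    by (rule lipschitz_onD[OF lipschitz]) (use k in auto)
  also have "dist (real k / N) (real (k + 1) / N) = 1 / N"
    by (simp add: dist_real_def add_divide_distrib)
  finally show "\<beta> (real k / real N) - \<beta> (real (k + 1) / real N) \<le> L / N"
    by (simp add: dist_real_def)
qed

lemma discounted_cost_eq:
  assumes "N \<ge> 1"
  shows "(\<Sum>k<N. \<beta> (real k / real N) * (l (traj f u x k, u k) - c)) =
    disc_rot_cost N u - lam x + disc_storage N u"
proof -
  have "(\<Sum>k<N. \<beta> (real k / real N) * (l (traj f u x k, u k) - c)) = disc_rot_cost N u +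
      (\<Sum>k<N. \<beta> (real k / real N) * (lam (traj f u x (Suc k)) - lam (traj f u x k)))"
    unfolding disc_rot_cost_def by (simp add: rot_def algebra_simps flip: sum.distrib)
  \<comment> \<open>For \<open>N \<ge> 1\<close> the final weight is \<open>\<beta> 1 = 0\<close>,
    so no terminal storage survives, and the initial weight \<open>\<beta> 0 = 1\<close> leaves
    \<open>- lam x\<close>.\<close>
  then show ?thesis
    using assms sum_by_parts[where b = "\<lambda>k. \<beta> (real k / real N)" and N = N
        and g = "\<lambda>k. lam (traj f u x k)"]
    by (simp add: disc_storage_def add.commute)
qed

section \<open>Size and limit of the storage term\<close>

text \<open>The weights are nonnegative and sum to \<open>1\<close>, so this is a convex combination
  of storage values.\<close>

lemma disc_storage_bound:
  assumes "u \<in> admissible f X U N x" "N \<ge> 1"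
  shows "\<bar>disc_storage N u\<bar> \<le> lam_bar"
proof -
  have "\<bar>disc_storage N u\<bar> \<le> (\<Sum>k<N. (\<beta> (real k / real N) - \<beta> (real (k + 1) / real N)) * lam_bar)"
    unfolding disc_storage_def
  proof (rule order_trans[OF sum_abs sum_mono])
    fix k assume k: "k \<in> {..<N}"
    then have "traj f u x (Suc k) \<in> X"
      using admissible_Dom[OF assms(1), of k] by (simp add: Dom_def)
    then show "\<bar>(\<beta> (real k / real N) - \<beta> (real (k + 1) / real N)) * lam (traj f u x (Suc k))\<bar>
        \<le> (\<beta> (real k / real N) - \<beta> (real (k + 1) / real N)) * lam_bar"
      using lam_bound weight_bounds(1)[of k N] k
      by (simp only: abs_mult abs_of_nonneg lessThan_iff) (intro mult_left_mono; simp)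
  qed
  also have "\<dots> = lam_bar"
    using sum_weights[OF assms(2)] by (simp flip: sum_distrib_right)
  finally show ?thesis .
qed

text \<open>A bounded discounted rotated cost leaves only \<open>o(N)\<close> time steps away from the orbit: those
  before \<open>(1 - \<theta>) N\<close> are weighted by at least \<open>\<beta> (1 - \<theta>) > 0\<close>.\<close>

lemma count_far_from_orbit:
  assumes u: "u \<in> admissible f X U N x" and C: "disc_rot_cost N u \<le> C"
    and \<delta>: "\<delta> > 0" and \<theta>: "0 < \<theta>" "\<theta> < 1"
  shows "(\<Sum>k<N. of_bool (\<delta> \<le> orbit_dist p orb (traj f u x k, u k)))
    \<le> C / (\<alpha> \<delta> * \<beta> (1 - \<theta>)) + 2 * \<theta> * N + 1"
proof -
  have pos: "\<alpha> \<delta> > 0" "\<beta> (1 - \<theta>) > 0"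
    using \<alpha>_pos[OF \<delta>] discount_pos[OF discount] \<theta> by auto
  \<comment> \<open>The tail of the horizon, written as a symmetric neighbourhood of
    \<open>N\<close> to fit \<open>card_nat_near\<close>. Every far step before it contributes at
    least \<open>1\<close> to the quotient by
    \<open>\<alpha> \<delta> * \<beta> (1 - \<theta>)\<close>, as in Markov's inequality.\<close>
  let ?S = "{k::nat. \<bar>real k - N\<bar> < \<theta> * N}"
  have "(\<Sum>k<N. of_bool (\<delta> \<le> orbit_dist p orb (traj f u x k, u k)))
      \<le> (\<Sum>k<N. \<beta> (real k / real N) * rot (traj f u x k, u k) / (\<alpha> \<delta> * \<beta> (1 - \<theta>)) + of_bool (k \<in> ?S))"
  proof (rule sum_mono)
    fix k assume "k \<in> {..<N}"
    then have k: "k < N" by simp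
    let ?z = "(traj f u x k, u k)"
    have D: "?z \<in> Dom"
      using admissible_Dom[OF u k] .
    have nonneg: "0 \<le> \<beta> (real k / real N) * rot ?z / (\<alpha> \<delta> * \<beta> (1 - \<theta>))"
      using pos rot_nonneg[OF D] \<beta>_nonneg[of "real k / real N"] k by simp
    show "of_bool (\<delta> \<le> orbit_dist p orb ?z)
        \<le> \<beta> (real k / real N) * rot ?z / (\<alpha> \<delta> * \<beta> (1 - \<theta>)) + of_bool (k \<in> ?S)"
    proof (cases "\<delta> \<le> orbit_dist p orb ?z \<and> k \<notin> ?S")
      case True
      then have "real k / N \<le> 1 - \<theta>"
        using k by (simp add: field_simps)
      then have "\<beta> (1 - \<theta>) \<le> \<beta> (real k / N)"
        using \<theta> by (intro \<beta>_antimono) auto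
      moreover have "\<alpha> \<delta> \<le> rot ?z"
        using rot_ge_far[OF D] True \<delta> by simp
      ultimately have "\<alpha> \<delta> * \<beta> (1 - \<theta>) \<le> \<beta> (real k / N) * rot ?z"
        using pos by (subst mult.commute, intro mult_mono) auto
      then show ?thesis
        using pos True by simp
    next
      case False
      then show ?thesis using nonneg by auto
    qed
  qed
  also have "\<dots> = disc_rot_cost N u / (\<alpha> \<delta> * \<beta> (1 - \<theta>)) + real (card ({..<N} \<inter> ?S))"
    by (simp only: sum.distrib sum_of_bool_eq finite_lessThan Collect_mem_eq disc_rot_cost_def
      sum_divide_distrib)
  also have "\<dots> \<le> C / (\<alpha> \<delta> * \<beta> (1 - \<theta>)) + (2 * (\<theta> * N) + 1)"
  proof (intro add_mono divide_right_mono C)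
    have "card ({..<N} \<inter> ?S) \<le> card ?S"
      using \<theta> by (intro card_mono card_nat_near) auto
    also have "real (card ?S) \<le> 2 * (\<theta> * N) + 1"
      using \<theta> by (intro card_nat_near) auto
    finally show "real (card ({..<N} \<inter> ?S)) \<le> 2 * (\<theta> * N) + 1"
      by simp
  qed (use pos in auto)
  finally show ?thesis by simp
qed

text \<open>The block estimate with weights at most \<open>L / N\<close> has four errors: closeness
  within blocks and the tail share of far steps, each at most \<open>\<epsilon> / 4\<close>, and the
  variation of the weights and \<open>O(1 / N)\<close> remainders, together below
  \<open>\<epsilon> / 2\<close>. None depends on \<open>u\<close>, which gives uniformity.\<close>

lemma disc_storage_tendsto:
  assumes \<epsilon>: "\<epsilon> > 0"
  shows "eventually (\<lambda>N. \<forall>u\<in>admissible f X U N x. disc_rot_cost N u \<le> C \<longrightarrow>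
    \<bar>disc_storage N u - lam_avg\<bar> \<le> \<epsilon>) sequentially"
proof -
  define B where "B = 2 * lam_bar"
  have B: "B \<ge> 0"
    using lam_bar_nonneg by (simp add: B_def)
  define \<eta> where "\<eta> = \<epsilon> / (4 * real p * (L + 1))"
  have "real p * \<eta> = \<epsilon> / (4 * (L + 1))"
    using p_pos by (simp add: \<eta>_def)
  moreover have "L * (\<epsilon> / (4 * (L + 1))) \<le> \<epsilon> / 4"
    using \<epsilon> L_nonneg by (simp add: field_simps)
  ultimately have \<eta>: "\<eta> > 0" "L * (real p * \<eta>) \<le> \<epsilon> / 4"
    using \<epsilon> L_nonneg p_pos by (auto simp: \<eta>_def)
  obtain \<delta> where \<delta>: "\<delta> > 0" and block: "\<And>u x N a. u \<in> admissible f X U N x \<Longrightarrow> a + p \<le> N \<Longrightarrow>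
    \<bar>\<Sum>k = a..<a + p. lam (traj f u x (Suc k)) - lam_avg\<bar> \<le> real p * \<eta> + real p * B *
        (\<Sum>k = a..<a + p. of_bool (\<delta> \<le> orbit_dist p orb (traj f u x k, u k)))"
    using block_sum_lam[OF \<eta>(1)] unfolding B_def by blast
  define a where "a = L * (real p * B)"
  have a: "a \<ge> 0"
    using L_nonneg B by (simp add: a_def)
  \<comment> \<open>The tail share enters as \<open>2 * a * \<theta>\<close>; the cap
    \<open>1 / 2\<close> keeps \<open>\<beta> (1 - \<theta>)\<close> positive.\<close>
  define \<theta> where "\<theta> = min (1 / 2) (\<epsilon> / (8 * (a + 1)))"
  have \<theta>: "0 < \<theta>" "\<theta> < 1"
    using \<epsilon> a by (auto simp: \<theta>_def)
  have "2 * a * \<theta> \<le> 2 * a * (\<epsilon> / (8 * (a + 1)))"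
    using a by (intro mult_left_mono) (auto simp: \<theta>_def)
  also have "\<dots> \<le> \<epsilon> / 4"
    using a \<epsilon> by (simp add: field_simps)
  finally have a\<theta>: "2 * a * \<theta> \<le> \<epsilon> / 4" .
  define C' where "C' = C / (\<alpha> \<delta> * \<beta> (1 - \<theta>)) + 1"
  define \<tau> where "\<tau> N = (\<Sum>k<N - 1. \<bar>(\<beta> (real (k + 2) / N) - \<beta> (real (k + 1) / N))
      - (\<beta> (real (k + 1) / N) - \<beta> (real k / N))\<bar>)" for N
  have "\<tau> \<longlonglongrightarrow> 0"
    unfolding \<tau>_def using discount lipschitz
    by (intro sum_second_differences_tendsto_0) (auto simp: discount_function_def)
  then have "(\<lambda>N. (a * C' + a) / real N + real p * B * \<tau> N) \<longlonglongrightarrow> 0 + real p * B * 0"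
    by (intro tendsto_intros lim_const_over_n)
  then have "eventually (\<lambda>N. (a * C' + a) / real N + real p * B * \<tau> N < \<epsilon> / 2) sequentially"
    by (rule order_tendstoD) (use \<epsilon> in simp)
  moreover have "eventually (\<lambda>N. N \<ge> (1::nat)) sequentially"
    by (rule eventually_ge_at_top)
  ultimately show ?thesis
  proof eventually_elim
    case (elim N)
    show ?case
    proof (intro ballI impI)
      fix u assume u: "u \<in> admissible f X U N x" and C: "disc_rot_cost N u \<le> C"
      define w where "w k = \<beta> (real k / real N) - \<beta> (real (k + 1) / real N)" for k
      define g where "g k = lam (traj f u x (Suc k)) - lam_avg" for k
      define d :: "nat \<Rightarrow> real" where "d k = of_bool (\<delta> \<le> orbit_dist p orb (traj f u x k, u k))" for k
      \<comment> \<open>Cut off at the last index, since \<open>w N\<close> would evaluate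
        \<open>\<beta>\<close> outside the unit interval; \<open>N - 1\<close> second differences
        remain, as in \<open>\<tau> N\<close>.\<close>
      define e where "e k = (if Suc k < N then \<bar>w (Suc k) - w k\<bar> else 0)" for k
      have "disc_storage N u - lam_avg = (\<Sum>k<N. w k * lam (traj f u x (Suc k))) - (\<Sum>k<N. w k) * lam_avg"
        using sum_weights elim by (simp add: disc_storage_def w_def)
      also have "\<dots> = (\<Sum>k<N. w k * g k)"
        by (simp add: g_def right_diff_distrib sum_subtractf sum_distrib_right)
      finally have "\<bar>disc_storage N u - lam_avg\<bar> = \<bar>\<Sum>k<N. w k * g k\<bar>"
        by simp
      also have "\<dots> \<le> real N * (L / N) * (real p * \<eta>) + (L / N) * (real p * B) * sum d {..<N}
          + real p * B * sum e {..<N} + real p * (L / N) * B"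
      proof (rule weighted_block_sum_bound[OF p_pos])
        fix k assume k: "k < N"
        then show "0 \<le> w k \<and> w k \<le> L / N"
          using weight_bounds by (simp add: w_def)
        have "traj f u x (Suc k) \<in> X"
          using admissible_Dom[OF u k] by (simp add: Dom_def)
        then show "\<bar>g k\<bar> \<le> B"
          unfolding g_def B_def using lam_bound lam_avg_bound by fastforce
      next
        fix k assume "k + p \<le> N"
        then show "\<bar>sum g {k..<k + p}\<bar> \<le> real p * \<eta> + real p * B * sum d {k..<k + p}"
          unfolding g_def d_def by (rule block[OF u])
      qed (use \<eta> B L_nonneg in \<open>auto simp: e_def d_def\<close>)
      also have "real N * (L / N) * (real p * \<eta>) = L * (real p * \<eta>)"
        using elim by simp
      also have "(L / N) * (real p * B) * sum d {..<N} = a / N * sum d {..<N}"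
        by (simp add: a_def)
      also have "\<dots> \<le> a / N * (C' + 2 * \<theta> * N)"
        using count_far_from_orbit[OF u C \<delta> \<theta>] a
        by (intro mult_left_mono) (auto simp: d_def C'_def)
      also have "a / N * (C' + 2 * \<theta> * N) = a * C' / N + 2 * a * \<theta>"
        using elim by (simp add: field_simps)
      also have "sum e {..<N} = \<tau> N"
      proof -
        have "w (Suc k) - w k = - ((\<beta> (real (k + 2) / N) - \<beta> (real (k + 1) / N))
            - (\<beta> (real (k + 1) / N) - \<beta> (real k / N)))" for k
          by (simp add: w_def algebra_simps)
        then have "\<tau> N = (\<Sum>k<N - 1. \<bar>w (Suc k) - w k\<bar>)"
          by (simp only: \<tau>_def abs_minus_cancel)
        also have "\<dots> = sum e {..<N}"
          by (rule sum.mono_neutral_cong_left) (auto simp: e_def)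
        finally show ?thesis by simp
      qed
      finally have "\<bar>disc_storage N u - lam_avg\<bar> \<le>
          L * (real p * \<eta>) + 2 * a * \<theta> + ((a * C' + a) / N + real p * B * \<tau> N)"
        by (simp add: a_def add_divide_distrib algebra_simps)
      then show "\<bar>disc_storage N u - lam_avg\<bar> \<le> \<epsilon>"
        using \<eta>(2) a\<theta> elim by linarith
    qed
  qed
qed

section \<open>Cost of a transfer onto the orbit\<close>

text \<open>Local controllability with an orbit state as target: the target has distance
  \<open>0\<close> to the orbit, so the maximum in the bound reduces to the distance of
  \<open>y\<close>.\<close>

lemma connect_locally:
  "\<exists>M\<ge>1. \<exists>\<rho>. class_K_inf \<rho> \<and> (\<forall>y\<in>X. \<forall>j<p. norm (y - fst (orb j)) \<le> \<kappa> \<longrightarrow>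
    (\<exists>v\<in>admissible f X U M y. traj f v y M = fst (orb j) \<and>
      (\<forall>k<M. orbit_dist p orb (traj f v y k, v k) \<le> \<rho> (orbit_state_dist p orb y))))"
proof -
  obtain M \<rho> where M: "M \<ge> 1" "class_K_inf \<rho>"
    and ctrl: "\<And>z y y'. z \<in> (\<lambda>k. fst (orb k)) ` {..<p} \<Longrightarrow> y \<in> X \<Longrightarrow> y' \<in> X \<Longrightarrow>
      norm (y - z) \<le> \<kappa> \<Longrightarrow> norm (y' - z) \<le> \<kappa> \<Longrightarrow>
      \<exists>u\<in>admissible f X U M y. traj f u y M = y' \<and> (\<forall>k<M. orbit_dist p orb (traj f u y k, u k)
                 \<le> \<rho> (max (orbit_state_dist p orb y) (orbit_state_dist p orb y')))"
    using controllable unfolding locally_controllable_def by metis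
  have \<kappa>: "\<kappa> > 0"
    using controllable by (simp add: locally_controllable_def)
  have nonneg: "0 \<le> orbit_state_dist p orb y" for y
    using p_pos unfolding orbit_state_dist_def by (subst Min_ge_iff) auto
  have "orbit_state_dist p orb (fst (orb j)) \<le> 0" if "j < p" for j
    using that unfolding orbit_state_dist_def by (subst Min_le_iff) auto
  then have "max (orbit_state_dist p orb y) (orbit_state_dist p orb (fst (orb j))) = orbit_state_dist p orb y"
    if "j < p" for j y
    using nonneg[of y] nonneg[of "fst (orb j)"] that by (metis max_absorb1 order_trans)
  then show ?thesis
    using M ctrl[OF _ _ orb_state] \<kappa> by (intro exI[of _ M] conjI exI[of _ \<rho>]) force+
qed

text \<open>Reachability leads into the \<open>\<kappa>\<close>-ball of some orbit state, and local
  controllability closes the gap.\<close>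

lemma connecting_nonempty: "connecting \<noteq> {}"
proof -
  obtain K u where u: "u \<in> admissible f X U K x" "orbit_state_dist p orb (traj f u x K) \<le> \<kappa>"
    using reachable x unfolding finite_time_reachable_def by blast
  then obtain j where j: "j < p" "norm (traj f u x K - fst (orb j)) \<le> \<kappa>"
    using p_pos unfolding orbit_state_dist_def by (subst (asm) Min_le_iff) auto
  have "traj f u x K \<in> X"
    using u by (simp add: admissible_def)
  then obtain M v where "v \<in> admissible f X U M (traj f u x K)" "traj f v (traj f u x K) M = fst (orb j)"
    using connect_locally j by meson
  then have "(K + M, concat_control K u v) \<in> connecting"
    using u j by (auto simp: connecting_def traj_concat_control_add intro: admissible_concat_control)
  then show ?thesis by blast
qed

lemma transfer_cost_le: "(K, u) \<in> connecting \<Longrightarrow> transfer_cost \<le> rot_cost K u"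
  unfolding transfer_cost_def
  by (rule order_trans[OF cINF_lower])
    (auto intro!: bdd_belowI[of _ 0] simp: rot_cost_nonneg connecting_def)

text \<open>A nearly optimal transfer has a length \<open>K\<close> independent of \<open>N\<close>;
  it is continued along the orbit at zero rotated cost, and discounting only lowers a sum of
  nonnegative costs.\<close>

lemma disc_rot_cost_upper:
  assumes "\<epsilon> > 0"
  shows "eventually (\<lambda>N. \<exists>u\<in>admissible f X U N x. disc_rot_cost N u \<le> transfer_cost + \<epsilon>) sequentially"
proof -
  have "\<exists>s\<in>(\<lambda>(K, u). rot_cost K u) ` connecting. s < transfer_cost + \<epsilon>"
    unfolding transfer_cost_def using connecting_nonempty assms
    by (intro cInf_lessD) (auto simp: transfer_cost_def)
  then obtain K u where "(K, u) \<in> connecting" and cost: "rot_cost K u < transfer_cost + \<epsilon>"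
    by auto
  then obtain j where u: "u \<in> admissible f X U K x" and j: "j < p" "traj f u x K = fst (orb j)"
    by (auto simp: connecting_def)
  show ?thesis
  proof (rule eventually_sequentiallyI)
    fix N assume "K \<le> N"
    then obtain M where N: "N = K + M"
      using le_Suc_ex by blast
    let ?v = "concat_control K u (orbit_control j)"
    have v: "?v \<in> admissible f X U N x"
      unfolding N using u j orbit_control_admissible[OF j(1)] by (intro admissible_concat_control) auto
    have "rot_cost N ?v = rot_cost K u"
      unfolding rot_cost_def N sum_concat_control using j by (simp add: rot_orbit_control)
    then have "disc_rot_cost N ?v \<le> transfer_cost + \<epsilon>"
      using disc_rot_cost_le[OF v] cost by linarith
    then show "\<exists>u\<in>admissible f X U N x. disc_rot_cost N u \<le> transfer_cost + \<epsilon>"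
      using v by blast
  qed
qed

text \<open>A path of small discounted rotated cost comes close to the orbit within a time independent of
  \<open>N\<close>, can be connected to it there at small cost, and up to that time the discount
  weights are close to \<open>1\<close>.\<close>

lemma disc_rot_cost_lower:
  assumes \<epsilon>: "\<epsilon> > 0"
  shows "eventually (\<lambda>N. \<forall>u\<in>admissible f X U N x. transfer_cost - \<epsilon> \<le> disc_rot_cost N u) sequentially"
proof -
  obtain M \<rho> where M: "M \<ge> 1" and \<rho>: "class_K_inf \<rho>"
    and connect: "\<And>y j. y \<in> X \<Longrightarrow> j < p \<Longrightarrow> norm (y - fst (orb j)) \<le> \<kappa> \<Longrightarrow>
      \<exists>v\<in>admissible f X U M y. traj f v y M = fst (orb j) \<and>
        (\<forall>k<M. orbit_dist p orb (traj f v y k, v k) \<le> \<rho> (orbit_state_dist p orb y))"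
    using connect_locally by metis
  \<comment> \<open>The connection takes \<open>M\<close> steps, each allowed a rotated cost of
    \<open>\<epsilon> / (2 * M)\<close>, hence \<open>\<epsilon> / 2\<close> in total.\<close>
  obtain \<delta>1 where \<delta>1: "\<delta>1 > 0"
    "\<And>z j. z \<in> Dom \<Longrightarrow> j < p \<Longrightarrow> norm (z - orb j) < \<delta>1 \<Longrightarrow> dist (rot z) (rot (orb j)) < \<epsilon> / (2 * M)"
    using continuous_near_orbit[OF cont_rot, of "\<epsilon> / (2 * M)"] \<epsilon> M by auto
  have "continuous_on {0..} \<rho>" "\<rho> 0 = 0"
    using \<rho> by (auto simp: class_K_inf_def)
  then obtain \<delta>2 where "\<delta>2 > 0" "\<forall>s\<in>{0..}. dist s 0 < \<delta>2 \<longrightarrow> dist (\<rho> s) (\<rho> 0) < \<delta>1"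
    using \<delta>1(1) unfolding continuous_on_iff by (meson atLeast_iff order_refl)
  then have \<delta>2: "\<delta>2 > 0" "\<And>s. 0 \<le> s \<Longrightarrow> s < \<delta>2 \<Longrightarrow> \<rho> s < \<delta>1"
    using \<open>\<rho> 0 = 0\<close> by (auto simp: dist_real_def)
  have \<kappa>: "\<kappa> > 0"
    using controllable by (simp add: locally_controllable_def)
  define \<delta> where "\<delta> = min \<kappa> \<delta>2"
  have \<delta>: "\<delta> > 0" "\<delta> \<le> \<kappa>" "\<delta> \<le> \<delta>2"
    using \<kappa> \<delta>2 by (auto simp: \<delta>_def)
  have b: "\<beta> (1 / 2) > 0"
    using discount_pos[OF discount] by simp
  have \<alpha>\<delta>: "\<alpha> \<delta> > 0"
    using \<alpha>_pos[OF \<delta>(1)] .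
  \<comment> \<open>If the first \<open>K\<close> steps all stayed \<open>\<delta>\<close> away from
    the orbit, their cost with weights at least \<open>\<beta> (1 / 2)\<close> would exceed
    \<open>transfer_cost\<close>; \<open>N \<ge> 2 * K + 1\<close> guarantees these weights.\<close>
  obtain K :: nat where K: "real K > transfer_cost / (\<beta> (1 / 2) * \<alpha> \<delta>)"
    using reals_Archimedean2 by blast
  have "continuous_on {0..1} \<beta>"
    using lipschitz by (rule lipschitz_on_continuous_on)
  moreover have "(\<lambda>N. real K / real N) \<longlonglongrightarrow> 0"
    by (rule lim_const_over_n)
  moreover have "eventually (\<lambda>N. real K / real N \<in> {0..1}) sequentially"
    using eventually_ge_at_top[of "Suc K"] by eventually_elim auto
  ultimately have "(\<lambda>N. \<beta> (real K / real N)) \<longlonglongrightarrow> \<beta> 0"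
    using continuous_on_tendsto_compose[of "{0..1}" \<beta> "\<lambda>N. real K / real N" 0] by simp
  \<comment> \<open>Up to time \<open>K\<close> every weight is at least
    \<open>\<beta> (K / N)\<close>, which tends to \<open>1\<close>; the other
    \<open>\<epsilon> / 2\<close> pays for this scaling.\<close>
  then have "(\<lambda>N. \<beta> (real K / real N) * (transfer_cost - \<epsilon> / 2)) \<longlonglongrightarrow> 1 * (transfer_cost - \<epsilon> / 2)"
    by (intro tendsto_intros) simp
  then have "eventually (\<lambda>N. transfer_cost - \<epsilon> < \<beta> (real K / real N) * (transfer_cost - \<epsilon> / 2)) sequentially"
    by (rule order_tendstoD) (use \<epsilon> in simp)
  moreover have "eventually (\<lambda>N. N \<ge> 2 * K + 1) sequentially"
    by (rule eventually_ge_at_top)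
  ultimately show ?thesis
  proof eventually_elim
    case (elim N)
    show ?case
    proof (intro ballI, rule ccontr)
      \<comment> \<open>Arguing by contradiction supplies an upper bound on the cost of
        \<open>u\<close>, which is what forces an early approach to the orbit.\<close>
      fix u assume u: "u \<in> admissible f X U N x" and "\<not> transfer_cost - \<epsilon> \<le> disc_rot_cost N u"
      then have small: "disc_rot_cost N u < transfer_cost - \<epsilon>"
        by simp
      have nonneg: "0 \<le> \<beta> (real k / real N) * rot (traj f u x k, u k)" if "k < N" for k
        using that by (intro mult_nonneg_nonneg \<beta>_nonneg rot_nonneg admissible_Dom[OF u]) auto
      have prefix: "(\<Sum>k<n. \<beta> (real k / real N) * rot (traj f u x k, u k)) \<le> disc_rot_cost N u"
        if "n \<le> N" for n
        unfolding disc_rot_cost_def using that nonneg by (intro sum_mono2) auto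
      have "\<exists>k<K. orbit_dist p orb (traj f u x k, u k) < \<delta>"
      proof (rule ccontr)
        assume far: "\<not> ?thesis"
        have "real K * (\<beta> (1 / 2) * \<alpha> \<delta>) = (\<Sum>k<K. \<beta> (1 / 2) * \<alpha> \<delta>)"
          by simp
        also have "\<dots> \<le> (\<Sum>k<K. \<beta> (real k / real N) * rot (traj f u x k, u k))"
        proof (rule sum_mono)
          fix k assume "k \<in> {..<K}"
          then have k: "k < K" by simp
          have "real k / real N \<le> 1 / 2"
            using k elim by (simp add: field_simps)
          then have "\<beta> (1 / 2) \<le> \<beta> (real k / real N)"
            by (intro \<beta>_antimono) auto
          moreover have "\<not> orbit_dist p orb (traj f u x k, u k) < \<delta>"
            using far k by blast
          then have "\<alpha> \<delta> \<le> rot (traj f u x k, u k)"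
            using k elim \<delta> by (intro rot_ge_far admissible_Dom[OF u]) auto
          ultimately show "\<beta> (1 / 2) * \<alpha> \<delta> \<le> \<beta> (real k / real N) * rot (traj f u x k, u k)"
            using b \<alpha>\<delta> by (intro mult_mono) auto
        qed
        also have "\<dots> < transfer_cost"
          using prefix[of K] elim small \<epsilon> by simp
        finally show False
          using K b \<alpha>\<delta> by (simp add: field_simps)
      qed
      then obtain n j where n: "n < K" and j: "j < p" "norm ((traj f u x n, u n) - orb j) < \<delta>"
        by (auto simp: orbit_dist_less_iff)
      let ?y = "traj f u x n"
      have un: "u \<in> admissible f X U n x"
        by (rule admissible_mono[OF u]) (use n elim in simp)
      then have y: "?y \<in> X"
        by (simp add: admissible_def)
      have yj: "norm (?y - fst (orb j)) < \<delta>"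
        using norm_fst_le[of "?y - fst (orb j)" "u n - snd (orb j)"] j by (cases "orb j") auto
      then obtain v where v: "v \<in> admissible f X U M ?y" "traj f v ?y M = fst (orb j)"
        and v_dist: "\<And>k. k < M \<Longrightarrow> orbit_dist p orb (traj f v ?y k, v k) \<le> \<rho> (orbit_state_dist p orb ?y)"
        using connect[OF y j(1)] \<delta> by auto
      have "0 \<le> orbit_state_dist p orb ?y" "orbit_state_dist p orb ?y < \<delta>2"
        using p_pos yj j \<delta> unfolding orbit_state_dist_def
        by (subst Min_ge_iff Min_less_iff; force)+
      then have "\<rho> (orbit_state_dist p orb ?y) < \<delta>1"
        by (rule \<delta>2(2))
      have "(\<Sum>k<M. rot (traj f v ?y k, v k)) \<le> (\<Sum>k<M. \<epsilon> / (2 * M))"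
      proof (rule sum_mono)
        fix k assume "k \<in> {..<M}"
        then have k: "k < M" by simp
        have "orbit_dist p orb (traj f v ?y k, v k) < \<delta>1"
          using v_dist[OF k] \<open>\<rho> (orbit_state_dist p orb ?y) < \<delta>1\<close> by linarith
        then obtain i where i: "i < p" "norm ((traj f v ?y k, v k) - orb i) < \<delta>1"
          by (auto simp: orbit_dist_less_iff)
        then have "dist (rot (traj f v ?y k, v k)) (rot (orb i)) < \<epsilon> / (2 * M)"
          by (intro \<delta>1(2) admissible_Dom[OF v(1) k])
        then show "rot (traj f v ?y k, v k) \<le> \<epsilon> / (2 * M)"
          using rot_orb_zero[OF i(1)] by (simp add: dist_real_def)
      qed
      also have "\<dots> = \<epsilon> / 2"
        using M by simp
      finally have local: "(\<Sum>k<M. rot (traj f v ?y k, v k)) \<le> \<epsilon> / 2" .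
      have "(n + M, concat_control n u v) \<in> connecting"
        using un v j by (auto simp: connecting_def traj_concat_control_add intro: admissible_concat_control)
      then have "transfer_cost \<le> rot_cost (n + M) (concat_control n u v)"
        by (rule transfer_cost_le)
      also have "\<dots> \<le> rot_cost n u + \<epsilon> / 2"
        unfolding rot_cost_def sum_concat_control using local by simp
      finally have "transfer_cost - \<epsilon> / 2 \<le> rot_cost n u"
        by simp
      then have "\<beta> (real K / real N) * (transfer_cost - \<epsilon> / 2) \<le> \<beta> (real K / real N) * rot_cost n u"
        using elim by (intro mult_left_mono \<beta>_nonneg) auto
      also have "\<dots> \<le> (\<Sum>k<n. \<beta> (real k / real N) * rot (traj f u x k, u k))"
        unfolding rot_cost_def sum_distrib_left
      proof (rule sum_mono)
        fix k assume "k \<in> {..<n}"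
        then have "\<beta> (real K / real N) \<le> \<beta> (real k / real N)"
          using n elim by (intro \<beta>_antimono) (auto intro!: divide_right_mono)
        moreover have "0 \<le> rot (traj f u x k, u k)"
          using \<open>k \<in> {..<n}\<close> by (intro rot_nonneg admissible_Dom[OF un]) auto
        ultimately show "\<beta> (real K / real N) * rot (traj f u x k, u k)
            \<le> \<beta> (real k / real N) * rot (traj f u x k, u k)"
          by (rule mult_right_mono)
      qed
      also have "\<dots> \<le> disc_rot_cost N u"
        using n elim by (intro prefix) simp
      finally show False
        using small elim by linarith
    qed
  qed
qed

section \<open>Identification of the limit\<close>

lemma discounted_value_tendsto:
  "(\<lambda>N. discounted_value f l X U c \<beta> N x) \<longlonglongrightarrow> ereal (transfer_cost - lam x + lam_avg)"
proof -
  define V where "V = transfer_cost - lam x + lam_avg"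
  \<comment> \<open>Controls with rotated cost above \<open>C\<close> already exceed
    \<open>V\<close>, since the storage term and \<open>lam_avg\<close> are bounded by
    \<open>lam_bar\<close>; the nearly optimal controls stay below \<open>C\<close>. So the uniform
    storage limit covers all that matter.\<close>
  define C where "C = transfer_cost + 2 * lam_bar + 1"
  have ev: "eventually (\<lambda>N. ereal (V - \<epsilon>) \<le> discounted_value f l X U c \<beta> N x \<and>
      discounted_value f l X U c \<beta> N x \<le> ereal (V + \<epsilon>)) sequentially" if "0 < \<epsilon>" "\<epsilon> < 1" for \<epsilon>
  proof -
    have "eventually (\<lambda>N. \<forall>u\<in>admissible f X U N x. disc_rot_cost N u \<le> C \<longrightarrow>
        \<bar>disc_storage N u - lam_avg\<bar> \<le> \<epsilon> / 2) sequentially"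
      by (rule disc_storage_tendsto) (use that in simp)
    moreover have "eventually (\<lambda>N. \<exists>u\<in>admissible f X U N x. disc_rot_cost N u \<le> transfer_cost + \<epsilon> / 2) sequentially"
      by (rule disc_rot_cost_upper) (use that in simp)
    moreover have "eventually (\<lambda>N. \<forall>u\<in>admissible f X U N x. transfer_cost - \<epsilon> / 2 \<le> disc_rot_cost N u) sequentially"
      by (rule disc_rot_cost_lower) (use that in simp)
    moreover have "eventually (\<lambda>N. N \<ge> (1::nat)) sequentially"
      by (rule eventually_ge_at_top)
    ultimately show ?thesis
    proof eventually_elim
      case (elim N)
      note eq = discounted_cost_eq[OF \<open>N \<ge> 1\<close>]
      have lower: "V - \<epsilon> \<le> disc_rot_cost N u - lam x + disc_storage N u"
        if u: "u \<in> admissible f X U N x" for u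
      proof (cases "disc_rot_cost N u \<le> C")
        case True
        then have "\<bar>disc_storage N u - lam_avg\<bar> \<le> \<epsilon> / 2" "transfer_cost - \<epsilon> / 2 \<le> disc_rot_cost N u"
          using elim u by auto
        then show ?thesis
          unfolding V_def abs_le_iff by linarith
      next
        case False
        moreover have "\<bar>disc_storage N u\<bar> \<le> lam_bar"
          using disc_storage_bound[OF u \<open>N \<ge> 1\<close>] .
        ultimately show ?thesis
          using lam_avg_bound \<open>0 < \<epsilon>\<close> unfolding V_def C_def abs_le_iff by linarith
      qed
      obtain u where u: "u \<in> admissible f X U N x" "disc_rot_cost N u \<le> transfer_cost + \<epsilon> / 2"
        using elim by blast
      moreover from this have "\<bar>disc_storage N u - lam_avg\<bar> \<le> \<epsilon> / 2"
        using elim(1) lam_bar_nonneg that by (auto simp: C_def)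
      ultimately have "disc_rot_cost N u - lam x + disc_storage N u \<le> V + \<epsilon>"
        unfolding V_def abs_le_iff by linarith
      then have "discounted_value f l X U c \<beta> N x \<le> ereal (V + \<epsilon>)"
        unfolding discounted_value_def eq by (intro INF_lower2[OF u(1)]) simp
      moreover have "ereal (V - \<epsilon>) \<le> discounted_value f l X U c \<beta> N x"
        unfolding discounted_value_def eq using lower by (intro INF_greatest) simp
      ultimately show ?case by simp
    qed
  qed
  show ?thesis
    unfolding V_def[symmetric]
  proof (rule order_tendstoI)
    fix a assume "a < ereal V"
    then obtain b where b: "a < ereal b" "b < V"
      using ereal_dense2 by (metis less_ereal.simps(1))
    \<comment> \<open>The estimate \<open>ev\<close> holds for \<open>\<epsilon>\<close> strictly
      between \<open>0\<close> and \<open>1\<close>, hence the minimum with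
      \<open>1 / 2\<close>.\<close>
    have "eventually (\<lambda>N. ereal (V - min (1 / 2) (V - b)) \<le> discounted_value f l X U c \<beta> N x) sequentially"
      by (rule eventually_mono[OF ev]) (use b in auto)
    then show "eventually (\<lambda>N. a < discounted_value f l X U c \<beta> N x) sequentially"
    proof eventually_elim
      case (elim N)
      have "ereal b \<le> ereal (V - min (1 / 2) (V - b))"
        by simp
      then show ?case
        using b elim by (meson less_le_trans order_trans)
    qed
  next
    fix a assume "ereal V < a"
    then obtain b where b: "ereal b < a" "V < b"
      using ereal_dense2 by (metis less_ereal.simps(1))
    have "eventually (\<lambda>N. discounted_value f l X U c \<beta> N x \<le> ereal (V + min (1 / 2) (b - V))) sequentially"
      by (rule eventually_mono[OF ev]) (use b in auto)
    then show "eventually (\<lambda>N. discounted_value f l X U c \<beta> N x < a) sequentially"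
    proof eventually_elim
      case (elim N)
      have "ereal (V + min (1 / 2) (b - V)) \<le> ereal b"
        by simp
      then show ?case
        using b elim by (meson le_less_trans order_trans)
    qed
  qed
qed

end

theorem theorem22:
  fixes f :: "(real ^ 'n) \<times> (real ^ 'm) \<Rightarrow> real ^ 'n"
    and l :: "(real ^ 'n) \<times> (real ^ 'm) \<Rightarrow> real"
    and X :: "(real ^ 'n) set" and U :: "(real ^ 'm) set"
    and l_star \<kappa> :: real and \<beta> :: "real \<Rightarrow> real"
    and p :: nat and orb :: "nat \<Rightarrow> (real ^ 'n) \<times> (real ^ 'm)"
    and x :: "real ^ 'n"
  assumes "\<forall>y\<in>X. optimal_average f l X U y = ereal l_star"
    and "continuity_compactness f l X U"
    and "strictly_dissipative f l X U l_star p orb"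
    and "locally_controllable f X U p orb \<kappa>"
    and "finite_time_reachable f X U p orb \<kappa>"
    and "discount_function \<beta>"
    and "x \<in> X"
  shows "\<exists>V :: real. (\<lambda>N. discounted_value f l X U l_star \<beta> N x) \<longlonglongrightarrow> ereal V"
proof -
  obtain lam lam_bar \<alpha> where lam: "continuous_on X lam" "\<forall>x\<in>X. \<bar>lam x\<bar> \<le> lam_bar" "class_K_inf \<alpha>"
    "\<forall>x\<in>X. \<forall>u\<in>admissible f X U 1 x.
       (l (x, u 0) - l_star) + lam x - lam (f (x, u 0)) \<ge> \<alpha> (orbit_dist p orb (x, u 0))"
    using assms(3) unfolding strictly_dissipative_def by blast
  obtain L where L: "L-lipschitz_on {0..1} \<beta>"
    using assms(6) by (auto simp: discount_function_def)
  interpret discounted_problem f l X U l_star p orb lam lam_bar \<alpha> \<beta> L \<kappa> x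
    using assms lam L
    by unfold_locales
      (auto simp: continuity_compactness_def strictly_dissipative_def optimal_orbit_def)
  show ?thesis
    using discounted_value_tendsto by blast
qed

end
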